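(* Let $p$ be a nonnegative integer and let $x_1,\dots,x_n$ be complex parameters such that no denominator below vanishes. Then $$\begin{aligned} (q)_{\infty}^{p+1} &=\sum_{k_1,\dots,k_n\ge0}\ \prod_{1\leq r<s\leq n}\frac{1-q^{k_{r}-k_{s}}x_{r}/x_{s}}{1-x_{r}/x_{s}}\cdot\frac{(1-q^{2|\boldsymbol{k}|+1})(q)_{|\boldsymbol{k}|}}{\prod_{r,s=1}^{n}(qx_{r}/x_{s})_{k_{r}}}\\ &\quad\times(-1)^{n|\boldsymbol{k}|}q^{\sum_{r=1}^{n}(r-1)k_{r}+n\sum_{i=1}^{n}\binom{k_{i}}{2}}\prod_{r=1}^{n}x_{r}^{nk_{r}-|\boldsymbol{k}|}\\ &\quad\times\sum_{\substack{0\leq m_{r}\leq k_{r}\\ r=1,\dots,n}}\ \prod_{1\leq r<s\leq n}\frac{1-q^{m_{r}-m_{s}}x_{r}/x_{s}}{1-x_{r}/x_{s}}\prod_{r,s=1}^{n}\frac{(q^{-k_{s}}x_{r}/x_{s})_{m_{r}}}{(qx_{r}/x_{s})_{m_{r}}}\cdot(q^{|\boldsymbol{k}|+1})_{|\boldsymbol{m}|}\,\big((q)_{|\boldsymbol{m}|}\big)^{p}q^{\sum_{r=1}^{n}rm_{r}} \end{aligned}$$ and $$\begin{aligned} (q)_{\infty}^{p+1} &=1+\sum_{\substack{k_{1},\dots,k_{n}\geq0\\ |\boldsymbol{k}|\geq1}}\ \prod_{1\leq r<s\leq n}\frac{1-q^{k_{r}-k_{s}}x_{r}/x_{s}}{1-x_{r}/x_{s}}\cdot\frac{(1-q^{2|\boldsymbol{k}|})(q)_{|\boldsymbol{k}|-1}}{\prod_{r,s=1}^{n}(qx_{r}/x_{s})_{k_{r}}}\\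 &\quad\times(-1)^{n|\boldsymbol{k}|}q^{\sum_{r=1}^{n}(r-1)k_{r}+n\sum_{i=1}^{n}\binom{k_{i}}{2}}\prod_{r=1}^{n}x_{r}^{nk_{r}-|\boldsymbol{k}|}\\ &\quad\times\sum_{\substack{0\leq m_{r}\leq k_{r}\\ r=1,\dots,n}}\ \prod_{1\leq r<s\leq n}\frac{1-q^{m_{r}-m_{s}}x_{r}/x_{s}}{1-x_{r}/x_{s}}\prod_{r,s=1}^{n}\frac{(q^{-k_{s}}x_{r}/x_{s})_{m_{r}}}{(qx_{r}/x_{s})_{m_{r}}}\cdot(q^{|\boldsymbol{k}|})_{|\boldsymbol{m}|}\,\big((q)_{|\boldsymbol{m}|}\big)^{p}q^{\sum_{r=1}^{n}rm_{r}}. \end{aligned}$$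
   Context: $q$ is a complex number with $0<|q|<1$ and $n\ge1$ is an integer. $(z)_\infty=\prod_{i\ge0}(1-zq^i)$ and $(z)_k=(z)_\infty/(zq^k)_\infty=\prod_{i=0}^{k-1}(1-zq^i)$; $(q)_\infty^{p}$ is the $p$-th power of $(q)_\infty$. Bold letters denote multi-indices of nonnegative integers, $\boldsymbol k=(k_1,\dots,k_n)$, with $|\boldsymbol k|=k_1+\cdots+k_n$. *)

theory Defs
  imports "HOL-Analysis.Analysis"
begin

definition qpoch :: "complex \<Rightarrow> complex \<Rightarrow> nat \<Rightarrow> complex" where
  "qpoch q z k = (\<Prod>i<k. 1 - z * q ^ i)"

definition qpoch_inf :: "complex \<Rightarrow> complex \<Rightarrow> complex" where
  "qpoch_inf q z = (\<Prod>i. 1 - z * q ^ i)"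

(* Multi-indices (k_1, ..., k_n) are extensional functions, so that each tuple
   corresponds to exactly one function and is summed over once. *)
definition multi_indices :: "nat \<Rightarrow> (nat \<Rightarrow> nat) set" where
  "multi_indices n = {1..n} \<rightarrow>\<^sub>E UNIV"

definition multi_indices_upto :: "nat \<Rightarrow> (nat \<Rightarrow> nat) \<Rightarrow> (nat \<Rightarrow> nat) set" where
  "multi_indices_upto n k = (\<Pi>\<^sub>E r\<in>{1..n}. {0..k r})"

definition msize :: "nat \<Rightarrow> (nat \<Rightarrow> nat) \<Rightarrow> nat" where
  "msize n k = (\<Sum>r=1..n. k r)"

definition vandermonde_quot ::
  "nat \<Rightarrow> complex \<Rightarrow> (nat \<Rightarrow> complex) \<Rightarrow> (nat \<Rightarrow> nat) \<Rightarrow> complex" where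
  "vandermonde_quot n q x k =
     (\<Prod>r\<in>{1..n}. \<Prod>s\<in>{r<..n}.
        (1 - q powi (int (k r) - int (k s)) * x r / x s) / (1 - x r / x s))"

(* The two identities differ only in a and in the factor
   (1 - q^(2|k|+1)) (q)_|k| resp. (1 - q^(2|k|)) (q)_(|k|-1) of the outer summand:
   inner_sum is used with a = q^(|k|+1) resp. a = q^|k|. *)
definition inner_sum ::
  "nat \<Rightarrow> complex \<Rightarrow> (nat \<Rightarrow> complex) \<Rightarrow> nat \<Rightarrow> complex \<Rightarrow> (nat \<Rightarrow> nat) \<Rightarrow> complex" where
  "inner_sum n q x p a k =
     (\<Sum>m\<in>multi_indices_upto n k.
        vandermonde_quot n q x m
        * (\<Prod>r=1..n. \<Prod>s=1..n.
             qpoch q (q powi (- int (k s)) * x r / x s) (m r)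
             / qpoch q (q * x r / x s) (m r))
        * qpoch q a (msize n m)
        * qpoch q q (msize n m) ^ p
        * q ^ (\<Sum>r=1..n. r * m r))"

definition outer_weight ::
  "nat \<Rightarrow> complex \<Rightarrow> (nat \<Rightarrow> complex) \<Rightarrow> (nat \<Rightarrow> nat) \<Rightarrow> complex" where
  "outer_weight n q x k =
     (-1) ^ (n * msize n k)
     * q ^ ((\<Sum>r=1..n. (r - 1) * k r) + n * (\<Sum>i=1..n. k i choose 2))
     * (\<Prod>r=1..n. x r powi (int n * int (k r) - int (msize n k)))"

definition summand1 ::
  "nat \<Rightarrow> complex \<Rightarrow> (nat \<Rightarrow> complex) \<Rightarrow> nat \<Rightarrow> (nat \<Rightarrow> nat) \<Rightarrow> complex" where
  "summand1 n q x p k =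
     vandermonde_quot n q x k
     * ((1 - q ^ (2 * msize n k + 1)) * qpoch q q (msize n k)
        / (\<Prod>r=1..n. \<Prod>s=1..n. qpoch q (q * x r / x s) (k r)))
     * outer_weight n q x k
     * inner_sum n q x p (q ^ (msize n k + 1)) k"

definition summand2 ::
  "nat \<Rightarrow> complex \<Rightarrow> (nat \<Rightarrow> complex) \<Rightarrow> nat \<Rightarrow> (nat \<Rightarrow> nat) \<Rightarrow> complex" where
  "summand2 n q x p k =
     vandermonde_quot n q x k
     * ((1 - q ^ (2 * msize n k)) * qpoch q q (msize n k - 1)
        / (\<Prod>r=1..n. \<Prod>s=1..n. qpoch q (q * x r / x s) (k r)))
     * outer_weight n q x k
     * inner_sum n q x p (q ^ msize n k) k"

end

theory Submission
  imports Defs "HOL-Computational_Algebra.Polynomial"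
begin

text \<open>
  Milne's fundamental theorem for \<open>U(n)\<close> basic hypergeometric series evaluates sums over \<open>|m| = M\<close>
  of the Vandermonde-type summands in closed form. Applied to the inner sum and to the outer
  sum over \<open>|k| = K\<close>, it shows that both depend on \<open>K\<close> only through their one-dimensional
  versions, so that everything reduces to \<open>n = 1\<close>. There the partial sums of the series telescope
  (the Bailey inversion), and Tannery's theorem identifies their limit.

  Absolute convergence of the \<open>n\<close>-fold series needs the cancellation in the inner sum: its factor
  \<open>(a)\<^sub>m (q)\<^sub>m\<^sup>p\<close> is an absolutely convergent series in powers \<open>q\<^sup>j\<^sup>m\<close>, and by the
  \<open>q\<close>-binomial theorem the alternating sum sends each power to a uniformly bounded number.
\<close>

subsection \<open>The \<open>q\<close>-Pochhammer symbol and the \<open>q\<close>-binomial theorem\<close>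

text \<open>Why termwise estimates fail: on the diagonal k_1 = ... = k_n the inner term m = k has
  size about |q|^(-binom(|k|,2)), and this exactly undoes the decay |q|^(sum (r-1) k_r + n sum
  binom(k_r,2)) of the outer weight. So the double sum over k and m does not converge absolutely,
  and the inner sum has to be bounded as a whole, uniformly in k, although the base q^(|k|+c) of one
  of its Pochhammer symbols moves with k. Why only |k| survives: the closed form in Milne's theorem
  depends on its parameters a_1, ..., a_n through their product alone. The inner sum has a_s =
  q^(-k_s), with product q^(-|k|); the outer sum is the confluent case of infinite a_s.\<close>

lemma qpoch_0 [simp]: "qpoch q z 0 = 1"
  by (simp add: qpoch_def)

lemma qpoch_Suc: "qpoch q z (Suc k) = qpoch q z k * (1 - z * q ^ k)"
  by (simp add: qpoch_def)

lemma qpoch_add: "qpoch q z (j + k) = qpoch q z j * qpoch q (z * q ^ j) k"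
  by (induction k) (simp_all add: qpoch_Suc power_add mult_ac)

lemma qpoch_eq_0_iff: "qpoch q z k = 0 \<longleftrightarrow> (\<exists>i<k. z * q ^ i = 1)"
  by (auto simp: qpoch_def)

lemma choose_2_Suc: "Suc n choose 2 = n + (n choose 2)"
  by (simp add: numeral_2_eq_2)

lemma choose_2_add: "(j + k) choose 2 = (j choose 2) + (k choose 2) + j * k"
  by (induction k) (simp_all add: choose_2_Suc algebra_simps)

text \<open>Values at \<open>q ^ m\<close> of one absolutely convergent power series. The bound
  \<open>C\<close> is carried along because it has to be uniform when the base of a Pochhammer
  symbol varies.\<close>

definition qpower_seq :: "complex \<Rightarrow> real \<Rightarrow> (nat \<Rightarrow> complex) \<Rightarrow> bool" where
  "qpower_seq q C G \<longleftrightarrow>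
     (\<exists>c. summable (\<lambda>j. norm (c j)) \<and> (\<Sum>j. norm (c j)) \<le> C \<and> (\<forall>m. G m = (\<Sum>j. c j * (q ^ m) ^ j)))"

definition qbinomial :: "complex \<Rightarrow> nat \<Rightarrow> nat \<Rightarrow> complex" where
  "qbinomial q n k = (if k \<le> n then qpoch q q n / (qpoch q q k * qpoch q q (n - k)) else 0)"

context
  fixes q :: complex
  assumes norm_q: "0 < norm q" "norm q < 1"
begin

lemma q_nonzero [simp]: "q \<noteq> 0"
  using norm_q by auto

lemma q_power_neq_1: "0 < k \<Longrightarrow> q ^ k \<noteq> 1"
  using norm_q by (metis norm_one norm_power power_less_one_iff less_irrefl norm_ge_zero)

lemma qpoch_q_nonzero [simp]: "qpoch q q k \<noteq> 0"
  using q_power_neq_1[of "Suc _"] by (auto simp: qpoch_eq_0_iff)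

text \<open>Each factor 1 - q^(i-k) equals -q^(i-k) (1 - q^(k-i)), so (q^(-k))_m is a reversed piece
  of (q)_k.\<close>

lemma qpoch_inverse_power:
  assumes "m \<le> k"
  shows "q ^ (k * m) * qpoch q (1 / q ^ k) m * qpoch q q (k - m)
           = (-1) ^ m * q ^ (m choose 2) * qpoch q q k"
  using assms
proof (induction m)
  case (Suc m)
  define j where "j = k - Suc m"
  have j: "k - m = Suc j" "k - Suc m = j" "k = Suc j + m"
    using Suc.prems by (simp_all add: j_def)
  have "q ^ (k * Suc m) * qpoch q (1 / q ^ k) (Suc m) * qpoch q q (k - Suc m)
      = q ^ (k * m) * qpoch q (1 / q ^ k) m * ((q ^ k - q ^ m) * qpoch q q j)"
    by (simp add: qpoch_Suc power_add j field_simps)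
  also have "(q ^ k - q ^ m) * qpoch q q j = - (q ^ m) * qpoch q q (k - m)"
    unfolding j by (simp add: qpoch_Suc power_add algebra_simps j)
  also have "q ^ (k * m) * qpoch q (1 / q ^ k) m * (- (q ^ m) * qpoch q q (k - m))
      = - (q ^ m) * ((-1) ^ m * q ^ (m choose 2) * qpoch q q k)"
    using Suc by (simp add: algebra_simps)
  finally show ?case
    by (simp add: choose_2_Suc power_add)
qed (simp add: numeral_2_eq_2)

lemma qbinomial_0 [simp]: "qbinomial q n 0 = 1"
  by (simp add: qbinomial_def)

lemma qbinomial_eq_0: "n < k \<Longrightarrow> qbinomial q n k = 0"
  by (simp add: qbinomial_def)

text \<open>Of the two q-Pascal rules this is the one that fits \<open>qpoch_Suc\<close>: the power
  q^(n-k) turns q^binom(k+1,2) into q^binom(k,2) q^n, as multiplication by 1 - z q^n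
  requires.\<close>

lemma qbinomial_Suc_Suc:
  assumes "k \<le> n"
  shows "qbinomial q (Suc n) (Suc k) = qbinomial q n (Suc k) + q ^ (n - k) * qbinomial q n k"
proof (cases "k = n")
  case False
  then obtain j where j: "n = k + Suc j"
    using assms by (metis add_Suc_right less_imp_Suc_add le_neq_implies_less)
  define u v where "u = 1 - q * q ^ k" and "v = 1 - q * q ^ j"
  have nz: "u \<noteq> 0" "v \<noteq> 0"
    using q_power_neq_1[of "Suc _"] by (auto simp: u_def v_def)
  have "1 - q * q ^ n = v + q * q ^ j * u"
    by (simp add: u_def v_def j power_add algebra_simps)
  then have "qbinomial q (Suc n) (Suc k)
      = qpoch q q n * (v + q * q ^ j * u) / (qpoch q q k * u * (qpoch q q j * v))"
    by (simp add: qbinomial_def j qpoch_Suc u_def v_def)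
  also have "\<dots> = qpoch q q n / (qpoch q q k * u * qpoch q q j)
      + q * q ^ j * (qpoch q q n / (qpoch q q k * (qpoch q q j * v)))"
    using nz by (simp add: divide_simps) (simp add: algebra_simps)?
  also have "\<dots> = qbinomial q n (Suc k) + q ^ (n - k) * qbinomial q n k"
    by (simp add: qbinomial_def j qpoch_Suc u_def v_def)
  finally show ?thesis .
qed (simp add: qbinomial_def)

lemma qbinomial_theorem:
  "(\<Sum>j\<le>n. (-1) ^ j * q ^ (j choose 2) * qbinomial q n j * z ^ j) = qpoch q z n"
proof (induction n)
  case (Suc n)
  define T where "T n j = (-1) ^ j * q ^ (j choose 2) * qbinomial q n j * z ^ j" for n j
  have step: "T (Suc n) (Suc j) = T n (Suc j) - z * q ^ n * T n j" if "j \<le> n" for j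
  proof -
    have "q ^ (Suc j choose 2) * q ^ (n - j) = q ^ (j choose 2) * q ^ n"
      using that by (simp add: choose_2_Suc flip: power_add)
    then have "(-1) ^ Suc j * (q ^ (Suc j choose 2) * qbinomial q n (Suc j)
        + q ^ (Suc j choose 2) * q ^ (n - j) * qbinomial q n j) * z ^ Suc j
      = T n (Suc j) - z * q ^ n * T n j"
      unfolding T_def by (simp add: ring_distribs mult_ac)
    then show ?thesis
      unfolding T_def qbinomial_Suc_Suc[OF that] by (simp only: ring_distribs mult.assoc)
  qed
  have "(\<Sum>j\<le>Suc n. T (Suc n) j) = T (Suc n) 0 + (\<Sum>j\<le>n. T (Suc n) (Suc j))"
    by (rule sum.atMost_Suc_shift)
  also have "(\<Sum>j\<le>n. T (Suc n) (Suc j)) = (\<Sum>j\<le>n. T n (Suc j)) - z * q ^ n * (\<Sum>j\<le>n. T n j)"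
    by (simp add: step sum_subtractf sum_distrib_left)
  also have "T (Suc n) 0 = T n 0"
    by (simp add: T_def)
  also have "T n 0 + ((\<Sum>j\<le>n. T n (Suc j)) - z * q ^ n * (\<Sum>j\<le>n. T n j))
      = (\<Sum>j\<le>Suc n. T n j) - z * q ^ n * (\<Sum>j\<le>n. T n j)"
    by (simp only: sum.atMost_Suc_shift add_diff_eq)
  also have "(\<Sum>j\<le>Suc n. T n j) = (\<Sum>j\<le>n. T n j)"
    by (simp add: qbinomial_eq_0 T_def)
  finally show ?case
    using Suc unfolding T_def by (simp only: qpoch_Suc) (simp only: ring_distribs mult_1_left mult_1_right mult.commute)
qed (simp add: qbinomial_def numeral_2_eq_2)

text \<open>The q-binomial theorem at z/q^k, once \<open>qpoch_inverse_power\<close> has turned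
  (q^(-k))_m/(q)_m into a Gaussian binomial coefficient.\<close>

lemma sum_qpoch_inverse_power:
  "(\<Sum>m\<le>k. qpoch q (1 / q ^ k) m / qpoch q q m * z ^ m) = qpoch q (z / q ^ k) k"
proof -
  have "qpoch q (1 / q ^ k) m / qpoch q q m * z ^ m
      = (-1) ^ m * q ^ (m choose 2) * qbinomial q k m * (z / q ^ k) ^ m" if "m \<le> k" for m
  proof -
    have "qpoch q (1 / q ^ k) m
        = (-1) ^ m * q ^ (m choose 2) * qpoch q q k / (q ^ (k * m) * qpoch q q (k - m))"
      using qpoch_inverse_power[OF that] by (simp add: eq_divide_eq mult_ac)
    then show ?thesis
      using that by (simp add: qbinomial_def power_mult power_divide)
  qed
  then show ?thesis
    by (simp add: qbinomial_theorem[symmetric])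
qed

text \<open>From 1 + t <= exp t in each factor and the geometric series of |q|; independent of base
  and length.\<close>

definition qpoch_bound :: real where
  "qpoch_bound = exp (1 / (1 - norm q))"

lemma norm_qpoch_le:
  assumes "norm z \<le> 1"
  shows "norm (qpoch q z k) \<le> qpoch_bound"
proof -
  have "norm (qpoch q z k) \<le> (\<Prod>i<k. exp (norm q ^ i))"
    unfolding qpoch_def prod_norm[symmetric]
  proof (intro prod_mono conjI norm_ge_zero)
    fix i
    have "norm (1 - z * q ^ i) \<le> 1 + norm z * norm q ^ i"
      by (metis norm_mult norm_one norm_power norm_triangle_ineq4)
    also have "\<dots> \<le> 1 + norm q ^ i"
      using assms by (simp add: mult_left_le_one_le)
    finally show "norm (1 - z * q ^ i) \<le> exp (norm q ^ i)"
      using exp_ge_add_one_self[of "norm q ^ i"] by linarith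
  qed
  also have "\<dots> = exp (\<Sum>i<k. norm q ^ i)"
    by (simp add: exp_sum)
  also have "(\<Sum>i<k. norm q ^ i) \<le> 1 / (1 - norm q)"
    using norm_q by (simp add: sum_gp_strict divide_right_mono)
  finally show ?thesis
    by (simp add: qpoch_bound_def)
qed

lemma qpoch_LIMSEQ: "qpoch q z \<longlonglongrightarrow> qpoch_inf q z"
  and convergent_prod_qpoch: "convergent_prod (\<lambda>i. 1 - z * q ^ i)"
proof -
  have "summable (\<lambda>i. norm (- z * q ^ i))"
    using norm_q by (simp add: norm_mult norm_power)
  then have "summable (\<lambda>i. norm ((1 - z * q ^ i) - 1))"
    by (simp add: norm_mult norm_power)
  then show conv: "convergent_prod (\<lambda>i. 1 - z * q ^ i)"
    by (intro abs_convergent_prod_imp_convergent_prod summable_imp_abs_convergent_prod)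
  have "(\<lambda>n. qpoch q z (Suc n)) \<longlonglongrightarrow> qpoch_inf q z"
    using convergent_prod_LIMSEQ[OF conv]
    by (simp add: qpoch_def qpoch_inf_def lessThan_Suc_atMost)
  then show "qpoch q z \<longlonglongrightarrow> qpoch_inf q z"
    by (rule LIMSEQ_imp_Suc)
qed

lemma qpoch_inf_nonzero:
  assumes "\<And>k. qpoch q z k \<noteq> 0"
  shows "qpoch_inf q z \<noteq> 0"
  unfolding qpoch_inf_def
proof (rule prodinf_nonzero[OF convergent_prod_qpoch])
  show "1 - z * q ^ i \<noteq> 0" for i
    using assms[of "Suc i"] by (simp add: qpoch_Suc)
qed

lemma inverse_qpoch_bounded:
  assumes "\<And>k. qpoch q z k \<noteq> 0"
  shows "\<exists>C. \<forall>k. norm (inverse (qpoch q z k)) \<le> C"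
proof -
  have "Bseq (\<lambda>k. inverse (qpoch q z k))"
    by (intro convergent_imp_Bseq convergentI[OF tendsto_inverse[OF qpoch_LIMSEQ]] qpoch_inf_nonzero assms)
  then show ?thesis
    by (auto simp: Bseq_def)
qed

subsection \<open>The terminating inner series\<close>

lemma summable_norm_power_div_qpoch:
  assumes "norm z < 1"
  shows "summable (\<lambda>j. norm (z ^ j / qpoch q q j))"
proof -
  obtain C where C: "\<And>k. norm (inverse (qpoch q q k)) \<le> C"
    using inverse_qpoch_bounded qpoch_q_nonzero by metis
  show ?thesis
  proof (rule summable_comparison_test')
    show "summable (\<lambda>j. norm z ^ j * C)"
      using assms by (intro summable_mult2 summable_geometric) auto
    show "norm (norm (z ^ j / qpoch q q j)) \<le> norm z ^ j * C" for j
      using mult_left_mono[OF C, of "norm z ^ j" j]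
      by (simp add: norm_mult norm_inverse norm_power divide_inverse)
  qed
qed

definition euler_series :: "complex \<Rightarrow> complex" where
  "euler_series z = (\<Sum>j. z ^ j / qpoch q q j)"

lemma norm_mult_q_power_less:
  assumes "norm z < 1"
  shows "norm (z * q ^ m) < 1"
proof -
  have "norm (z * q ^ m) \<le> norm z"
    using norm_q by (simp add: norm_mult norm_power mult_left_le power_le_one)
  with assms show ?thesis by simp
qed

text \<open>Passing from z to zq inserts q^j in the j-th term; the resulting 1 - q^j cancels the
  last factor of (q)_j, so the difference of the two series is z times the series.\<close>

lemma euler_series_shift:
  assumes "norm z < 1"
  shows "euler_series (z * q) = (1 - z) * euler_series z"
proof -
  have le: "norm (z * q) < 1"
    using norm_mult_q_power_less[OF assms, of 1] by simp
  note s = summable_norm_cancel[OF summable_norm_power_div_qpoch]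
  have "euler_series z - euler_series (z * q) = (\<Sum>j. z ^ j * (1 - q ^ j) / qpoch q q j)"
    unfolding euler_series_def
    by (subst suminf_diff[OF s[OF assms] s[OF le]]) (simp add: diff_divide_distrib algebra_simps)
  also have "\<dots> = (\<Sum>j. z ^ Suc j * (1 - q ^ Suc j) / qpoch q q (Suc j))"
  proof (subst suminf_split_head)
    show "summable (\<lambda>j. z ^ j * (1 - q ^ j) / qpoch q q j)"
      using summable_diff[OF s[OF assms] s[OF le]]
      by (simp add: diff_divide_distrib algebra_simps)
  qed simp
  also have "(\<lambda>j. z ^ Suc j * (1 - q ^ Suc j) / qpoch q q (Suc j)) = (\<lambda>j. z * (z ^ j / qpoch q q j))"
  proof
    fix j
    have "1 - q * q ^ j \<noteq> 0"
      using q_power_neq_1[of "Suc j"] by simp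
    then show "z ^ Suc j * (1 - q ^ Suc j) / qpoch q q (Suc j) = z * (z ^ j / qpoch q q j)"
      by (simp add: qpoch_Suc)
  qed
  also have "(\<Sum>j. z * (z ^ j / qpoch q q j)) = z * euler_series z"
    unfolding euler_series_def by (rule suminf_mult[OF s[OF assms]])
  finally show ?thesis
    by (simp add: algebra_simps)
qed

lemma euler_series_qpoch:
  assumes "norm z < 1"
  shows "euler_series (z * q ^ m) = qpoch q z m * euler_series z"
proof (induction m)
  case (Suc m)
  from euler_series_shift[OF norm_mult_q_power_less[OF assms]] show ?case
    using Suc by (simp add: qpoch_Suc mult_ac)
qed simp

text \<open>The iterated shift gives (z)_m E(z) = E(z q^m) for E = \<open>euler_series\<close>; now
  let m grow and use continuity of E at 0.\<close>

lemma qpoch_inf_euler_series: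
  assumes "norm z < 1"
  shows "qpoch_inf q z * euler_series z = 1"
proof (rule LIMSEQ_unique)
  show "(\<lambda>m. qpoch q z m * euler_series z) \<longlonglongrightarrow> qpoch_inf q z * euler_series z"
    by (intro tendsto_intros qpoch_LIMSEQ)
  have "isCont (\<lambda>z. \<Sum>j. (1 / qpoch q q j) * z ^ j) 0"
  proof (rule isCont_powser)
    show "summable (\<lambda>j. 1 / qpoch q q j * (1 / 2) ^ j)"
      using summable_norm_cancel[OF summable_norm_power_div_qpoch[of "1/2"]] by (simp add: mult.commute)
  qed simp
  then have cont: "isCont euler_series 0"
    unfolding euler_series_def by (simp add: mult.commute)
  have "(\<lambda>m. z * q ^ m) \<longlonglongrightarrow> z * 0"
    using norm_q by (intro tendsto_intros LIMSEQ_power_zero) auto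
  then have "(\<lambda>m. euler_series (z * q ^ m)) \<longlonglongrightarrow> euler_series 0"
    using isCont_tendsto_compose[OF cont] by simp
  moreover have "euler_series 0 = 1"
    using powser_zero[of "\<lambda>j. 1 / qpoch q q j"] by (simp add: euler_series_def)
  ultimately show "(\<lambda>m. qpoch q z m * euler_series z) \<longlonglongrightarrow> 1"
    by (simp add: euler_series_qpoch[OF assms])
qed

text \<open>In this form m enters only through q^m, as \<open>qpower_seq\<close> demands.\<close>

lemma qpoch_eq_euler_series:
  assumes "norm z < 1"
  shows "qpoch q z m = qpoch_inf q z * euler_series (z * q ^ m)"
  using qpoch_inf_euler_series[OF assms] euler_series_qpoch[OF assms, of m]
  by (metis mult.left_commute mult.right_neutral)

lemma norm_qpoch_inf_le:
  assumes "norm z \<le> 1"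
  shows "norm (qpoch_inf q z) \<le> qpoch_bound"
  by (rule LIMSEQ_le_const2[OF tendsto_norm[OF qpoch_LIMSEQ]])
     (auto intro: norm_qpoch_le[OF assms])

lemma qpoch_bound_pos: "0 < qpoch_bound"
  by (simp add: qpoch_bound_def)

text \<open>The closed disc |z| <= |q|, in place of |z| < 1, provides one majorant built from
  q^j/(q)_j for all bases at once; later the base is q^(k+c) with k varying.\<close>

lemma qpower_seq_qpoch:
  "\<exists>C. \<forall>z. norm z \<le> norm q \<longrightarrow> qpower_seq q C (qpoch q z)"
proof (intro exI allI impI)
  fix z :: complex assume z: "norm z \<le> norm q"
  then have z1: "norm z < 1"
    using norm_q by simp
  define c where "c j = qpoch_inf q z * (z ^ j / qpoch q q j)" for j
  have 1: "summable (\<lambda>j. norm (c j))"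
    unfolding c_def norm_mult by (intro summable_mult summable_norm_power_div_qpoch z1)
  have 2: "(\<Sum>j. norm (c j)) \<le> (\<Sum>j. qpoch_bound * norm (q ^ j / qpoch q q j))"
  proof (rule suminf_le[OF _ 1])
    show "norm (c j) \<le> qpoch_bound * norm (q ^ j / qpoch q q j)" for j
      unfolding c_def norm_mult norm_divide norm_power
      using z z1 qpoch_bound_pos
      by (intro mult_mono divide_right_mono power_mono norm_qpoch_inf_le) auto
    show "summable (\<lambda>j. qpoch_bound * norm (q ^ j / qpoch q q j))"
      using norm_q by (intro summable_mult summable_norm_power_div_qpoch)
  qed
  have 3: "qpoch q z m = (\<Sum>j. c j * (q ^ m) ^ j)" for m
  proof -
    have "qpoch_inf q z * euler_series (z * q ^ m)
        = (\<Sum>j. qpoch_inf q z * ((z * q ^ m) ^ j / qpoch q q j))"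
      unfolding euler_series_def
      by (intro suminf_mult[symmetric] summable_norm_cancel[OF summable_norm_power_div_qpoch]
          norm_mult_q_power_less z1)
    then show ?thesis
      by (simp add: qpoch_eq_euler_series[OF z1, of m] c_def power_mult_distrib mult_ac)
  qed
  show "qpower_seq q (\<Sum>j. qpoch_bound * norm (q ^ j / qpoch q q j)) (qpoch q z)"
    unfolding qpower_seq_def using 1 2 3 by blast
qed

text \<open>Absolutely summable sequences form a Banach algebra under the Cauchy product, so the
  constants multiply.\<close>

lemma qpower_seq_mult:
  assumes "qpower_seq q C F" "qpower_seq q D G"
  shows "qpower_seq q (C * D) (\<lambda>m. F m * G m)"
proof -
  obtain c where c: "summable (\<lambda>j. norm (c j))" "(\<Sum>j. norm (c j)) \<le> C"
      "\<And>m. F m = (\<Sum>j. c j * (q ^ m) ^ j)"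
    using assms(1) unfolding qpower_seq_def by metis
  obtain d where d: "summable (\<lambda>j. norm (d j))" "(\<Sum>j. norm (d j)) \<le> D"
      "\<And>m. G m = (\<Sum>j. d j * (q ^ m) ^ j)"
    using assms(2) unfolding qpower_seq_def by metis
  define e where "e k = (\<Sum>i\<le>k. c i * d (k - i))" for k
  have prod: "(\<lambda>k. \<Sum>i\<le>k. norm (c i) * norm (d (k - i))) sums ((\<Sum>j. norm (c j)) * (\<Sum>j. norm (d j)))"
    using Cauchy_product_sums[of "\<lambda>j. norm (c j)" "\<lambda>j. norm (d j)"] c(1) d(1) by simp
  have e_le: "norm (e k) \<le> (\<Sum>i\<le>k. norm (c i) * norm (d (k - i)))" for k
    unfolding e_def by (rule order.trans[OF norm_sum]) (simp add: norm_mult)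
  have 1: "summable (\<lambda>k. norm (e k))"
    by (rule summable_comparison_test'[OF sums_summable[OF prod]]) (use e_le in simp)
  have "(\<Sum>k. norm (e k)) \<le> (\<Sum>j. norm (c j)) * (\<Sum>j. norm (d j))"
    unfolding sums_unique[OF prod] by (intro suminf_le e_le 1 sums_summable[OF prod])
  also have "\<dots> \<le> C * D"
    using c d by (intro mult_mono order.trans[OF suminf_nonneg c(2)] suminf_nonneg) auto
  finally have 2: "(\<Sum>k. norm (e k)) \<le> C * D" .
  have 3: "F m * G m = (\<Sum>k. e k * (q ^ m) ^ k)" for m
  proof -
    have le: "norm ((q ^ m) ^ j) \<le> 1" for j
      using norm_q by (simp add: norm_power power_le_one flip: power_mult)
    have s: "summable (\<lambda>j. norm (b j * (q ^ m) ^ j))" if "summable (\<lambda>j. norm (b j))" for b :: "nat \<Rightarrow> complex"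
      by (rule summable_comparison_test'[OF that]) (use le in \<open>simp add: norm_mult mult_left_le\<close>)
    have "F m * G m = (\<Sum>k. \<Sum>i\<le>k. c i * (q ^ m) ^ i * (d (k - i) * (q ^ m) ^ (k - i)))"
      unfolding c d by (rule Cauchy_product[OF s[OF c(1)] s[OF d(1)]])
    also have "(\<lambda>k. \<Sum>i\<le>k. c i * (q ^ m) ^ i * (d (k - i) * (q ^ m) ^ (k - i)))
        = (\<lambda>k. e k * (q ^ m) ^ k)"
    proof
      fix k
      have "c i * (q ^ m) ^ i * (d (k - i) * (q ^ m) ^ (k - i)) = c i * d (k - i) * (q ^ m) ^ k"
        if "i \<le> k" for i
        using power_add[of "q ^ m" i "k - i"] that by (simp add: mult_ac)
      then show "(\<Sum>i\<le>k. c i * (q ^ m) ^ i * (d (k - i) * (q ^ m) ^ (k - i))) = e k * (q ^ m) ^ k"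
        unfolding e_def sum_distrib_right by (intro sum.cong) auto
    qed
    finally show ?thesis .
  qed
  show ?thesis
    unfolding qpower_seq_def using 1 2 3 by blast
qed

lemma qpower_seq_power:
  assumes "qpower_seq q C F"
  shows "qpower_seq q (C ^ p) (\<lambda>m. F m ^ p)"
proof (induction p)
  case 0
  have "summable (\<lambda>j. norm (if j = 0 then 1 else 0 :: complex))"
    using summable_single[of 0 "\<lambda>_. 1 :: real"] by (rule summable_cong[THEN iffD1, rotated]) auto
  moreover have "(\<Sum>j. norm (if j = 0 then 1 else 0 :: complex)) = 1"
    using suminf_finite[of "{0}" "\<lambda>j. norm (if j = 0 then 1 else 0 :: complex)"] by simp
  moreover have "(\<Sum>j. (if j = 0 then 1 else 0) * (q ^ m) ^ j) = 1" for m
    using suminf_finite[of "{0}" "\<lambda>j. (if j = 0 then 1 else 0) * (q ^ m) ^ j"] by simp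
  ultimately show ?case
    unfolding qpower_seq_def by (intro exI[of _ "\<lambda>j. if j = 0 then 1 else 0"]) auto
qed (simp add: qpower_seq_mult[OF assms])

section \<open>Boundedness of the terminating inner series\<close>

lemma norm_qpoch_shifted_le: "norm (qpoch q (q ^ Suc j / q ^ k) k) \<le> qpoch_bound"
proof (cases "j < k")
  \<comment> \<open>Here the exponent j + 1 - k is at most 0, so the factor with i = k - j - 1 is 1
    - 1.\<close>
  case True
  then have "q ^ Suc j * q ^ (k - Suc j) = q ^ k"
    by (simp only: power_add[symmetric]) simp
  then have "q ^ Suc j / q ^ k * q ^ (k - Suc j) = 1"
    by (simp del: power_Suc)
  then have "qpoch q (q ^ Suc j / q ^ k) k = 0"
    using True unfolding qpoch_eq_0_iff by (intro exI[of _ "k - Suc j"]) auto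
  then show ?thesis
    using qpoch_bound_pos by simp
next
  case False
  then have "q ^ Suc j / q ^ k = q ^ (Suc j - k)"
    by (simp add: power_diff)
  then show ?thesis
    using norm_q by (simp only:) (intro norm_qpoch_le, simp add: norm_power power_le_one)
qed

lemma norm_sum_qpoch_inverse_power_le:
  assumes "qpower_seq q C G"
  shows "norm (\<Sum>m\<le>k. qpoch q (1 / q ^ k) m / qpoch q q m * q ^ m * G m) \<le> C * qpoch_bound"
proof -
  obtain c where c: "summable (\<lambda>j. norm (c j))" "(\<Sum>j. norm (c j)) \<le> C"
      "\<And>m. G m = (\<Sum>j. c j * (q ^ m) ^ j)"
    using assms(1) unfolding qpower_seq_def by metis
  define w where "w m = qpoch q (1 / q ^ k) m / qpoch q q m * q ^ m" for m
  have le: "norm ((q ^ m) ^ j) \<le> 1" for j m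
    using norm_q by (simp add: norm_power power_le_one flip: power_mult)
  have s: "summable (\<lambda>j. c j * (q ^ m) ^ j)" for m
    by (rule summable_comparison_test'[OF c(1)]) (use le in \<open>simp add: norm_mult mult_left_le\<close>)
  have "(\<Sum>m\<le>k. w m * G m) = (\<Sum>m\<le>k. \<Sum>j. w m * (c j * (q ^ m) ^ j))"
    by (simp add: c suminf_mult[OF s])
  also have "\<dots> = (\<Sum>j. \<Sum>m\<le>k. w m * (c j * (q ^ m) ^ j))"
    by (intro suminf_sum[symmetric] summable_mult s)
  also have "(\<lambda>j. \<Sum>m\<le>k. w m * (c j * (q ^ m) ^ j))
      = (\<lambda>j. c j * qpoch q (q ^ Suc j / q ^ k) k)"
  proof
    fix j
    have "w m * (c j * (q ^ m) ^ j)
        = c j * (qpoch q (1 / q ^ k) m / qpoch q q m * (q ^ Suc j) ^ m)" for m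
    proof -
      have "q ^ m * (q ^ m) ^ j = (q ^ Suc j) ^ m"
        by (simp add: power_mult_distrib flip: power_mult) (simp add: mult.commute)
      then show ?thesis
        by (simp add: w_def mult_ac)
    qed
    then show "(\<Sum>m\<le>k. w m * (c j * (q ^ m) ^ j)) = c j * qpoch q (q ^ Suc j / q ^ k) k"
      by (simp only: sum_distrib_left[symmetric] sum_qpoch_inverse_power)
  qed
  finally have "norm (\<Sum>m\<le>k. w m * G m) = norm (\<Sum>j. c j * qpoch q (q ^ Suc j / q ^ k) k)"
    by simp
  also have "\<dots> \<le> (\<Sum>j. norm (c j) * qpoch_bound)"
  proof (rule norm_suminf_le)
    show "norm (c j * qpoch q (q ^ Suc j / q ^ k) k) \<le> norm (c j) * qpoch_bound" for j
      unfolding norm_mult by (intro mult_left_mono norm_qpoch_shifted_le norm_ge_zero)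
  qed (intro summable_mult2 c)
  also have "\<dots> = (\<Sum>j. norm (c j)) * qpoch_bound"
    by (intro suminf_mult2[symmetric] c)
  also have "\<dots> \<le> C * qpoch_bound"
    using c(2) qpoch_bound_pos by simp
  finally show ?thesis
    by (simp add: w_def)
qed

definition inner_series :: "nat \<Rightarrow> complex \<Rightarrow> nat \<Rightarrow> complex" where
  "inner_series p a k = (\<Sum>m\<le>k. qpoch q (1 / q ^ k) m / qpoch q q m * q ^ m * (qpoch q a m * qpoch q q m ^ p))"

lemma inner_series_bounded: "\<exists>C. \<forall>k. norm (inner_series p (q ^ (k + c)) k) \<le> C"
proof -
  obtain C where C: "\<And>z. norm z \<le> norm q \<Longrightarrow> qpower_seq q C (qpoch q z)"
    using qpower_seq_qpoch by blast
  define B where "B = C * C ^ p * qpoch_bound"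
  have B: "norm (inner_series p (q ^ (k + c)) k) \<le> B" if k: "0 < k" for k
    unfolding inner_series_def B_def
  proof (intro norm_sum_qpoch_inverse_power_le qpower_seq_mult qpower_seq_power C)
    show "norm (q ^ (k + c)) \<le> norm q"
      using norm_q k power_decreasing[of 1 "k + c" "norm q"] by (simp add: norm_power)
  qed simp
  \<comment> \<open>For k = c = 0 the base is 1, outside the disc |z| <= |q|, so k = 0 is covered by
    its own value.\<close>
  have "norm (inner_series p (q ^ (k + c)) k) \<le> max B (norm (inner_series p (q ^ c) 0))" for k
    using B[of k] by (cases k) auto
  then show ?thesis
    by blast
qed

subsection \<open>The one-dimensional expansion\<close>

text \<open>The one-dimensional k-th summand with (q^(-k))_m and (q^(k+c))_m absorbed into
  neighbouring Pochhammer symbols. Up to a constant it is Bailey inversion with a = q^c, applied to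
  f m/(q)_m.\<close>

definition bailey_sum :: "nat \<Rightarrow> (nat \<Rightarrow> complex) \<Rightarrow> nat \<Rightarrow> complex" where
  "bailey_sum c f k = (1 - q ^ (2 * k + c)) *
     (\<Sum>m\<le>k. (-1) ^ (k - m) * q ^ ((k - m) choose 2) * qpoch q q (k + m + c - 1)
        / (qpoch q q m * qpoch q q (k - m)) * f m)"

text \<open>Closed form of the partial sums of \<open>bailey_sum\<close>, up to the constant found
  in \<open>sum_bailey_sum\<close>.\<close>

definition bailey_partial :: "nat \<Rightarrow> (nat \<Rightarrow> complex) \<Rightarrow> nat \<Rightarrow> complex" where
  "bailey_partial c f k =
     (\<Sum>m\<le>k. (-1) ^ (k - m) * q ^ (Suc (k - m) choose 2) * qpoch q q (k + m + c)
        / (qpoch q q m * qpoch q q (k - m)) * f m)"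

text \<open>Compared coefficient by coefficient in \<open>f m\<close>. With j = k - m and u = 1 -
  q^(j+1) it reduces to -q^(j+1) (1 - q^(k+m+c+1)) = u - (1 - q^(2k+2+c)). The new index m = k + 1
  is treated apart, by \<open>diag\<close>.\<close>

lemma bailey_partial_Suc: "bailey_partial c f (Suc k) = bailey_partial c f k + bailey_sum c f (Suc k)"
proof -
  have *: "(-1) ^ (Suc k - m) * q ^ (Suc (Suc k - m) choose 2) * qpoch q q (Suc k + m + c)
        / (qpoch q q m * qpoch q q (Suc k - m)) * f m
      = (-1) ^ (k - m) * q ^ (Suc (k - m) choose 2) * qpoch q q (k + m + c)
        / (qpoch q q m * qpoch q q (k - m)) * f m
      + (1 - q ^ (2 * Suc k + c)) * ((-1) ^ (Suc k - m) * q ^ ((Suc k - m) choose 2) * qpoch q q (Suc k + m + c - 1)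
        / (qpoch q q m * qpoch q q (Suc k - m)) * f m)" if "m \<le> k" for m
  proof -
    define j where "j = k - m"
    have k: "k = m + j"
      using that by (simp add: j_def)
    define u where "u = 1 - q ^ Suc j"
    have "u \<noteq> 0"
      using q_power_neq_1[of "Suc j"] by (simp add: u_def)
    define A where "A = (-1) ^ j * q ^ (Suc j choose 2) * qpoch q q (k + m + c) / (qpoch q q m * qpoch q q j) * f m"
    have qj: "qpoch q q (Suc j) = qpoch q q j * u"
      by (simp add: qpoch_Suc u_def)
    have e: "q ^ (Suc (Suc j) choose 2) = q ^ Suc j * q ^ (Suc j choose 2)"
      by (simp only: choose_2_Suc[of "Suc j"] power_add)
    have s1: "(-1) ^ (Suc k - m) * q ^ (Suc (Suc k - m) choose 2) * qpoch q q (Suc k + m + c)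
        / (qpoch q q m * qpoch q q (Suc k - m)) * f m = - A * (q ^ Suc j * (1 - q ^ Suc (k + m + c))) / u"
      by (simp add: k Suc_diff_le e qj qpoch_Suc[of q q "m + j + m + c"] A_def mult_ac)
    have s2: "(-1) ^ (Suc k - m) * q ^ ((Suc k - m) choose 2) * qpoch q q (Suc k + m + c - 1)
        / (qpoch q q m * qpoch q q (Suc k - m)) * f m = - A / u"
      by (simp add: k Suc_diff_le qj A_def)
    have "q ^ Suc j * q ^ Suc (k + m + c) = q ^ (2 * Suc k + c)"
    proof -
      have "Suc j + Suc (k + m + c) = 2 * Suc k + c"
        by (simp add: k)
      then show ?thesis
        by (simp only: power_add[symmetric])
    qed
    then have "- A * (q ^ Suc j * (1 - q ^ Suc (k + m + c))) / u = A + (1 - q ^ (2 * Suc k + c)) * (- A / u)"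
      using \<open>u \<noteq> 0\<close> by (simp add: divide_simps) (simp add: u_def algebra_simps)
    then show ?thesis
      unfolding s1 s2 by (simp add: k A_def)
  qed
  have diag: "qpoch q q (Suc k + Suc k + c)
      = (1 - q ^ (2 * Suc k + c)) * qpoch q q (Suc k + Suc k + c - 1)"
  proof -
    define N where "N = Suc k + Suc k + c - 1"
    have "Suc k + Suc k + c = Suc N" "2 * Suc k + c = Suc N"
      by (simp_all add: N_def)
    then show ?thesis
      by (simp only: diff_Suc_1 qpoch_Suc power_Suc mult.commute)
  qed
  have S: "(\<Sum>m\<le>k. (-1) ^ (Suc k - m) * q ^ (Suc (Suc k - m) choose 2) * qpoch q q (Suc k + m + c)
          / (qpoch q q m * qpoch q q (Suc k - m)) * f m)
      = bailey_partial c f k + (1 - q ^ (2 * Suc k + c)) *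
        (\<Sum>m\<le>k. (-1) ^ (Suc k - m) * q ^ ((Suc k - m) choose 2) * qpoch q q (Suc k + m + c - 1)
          / (qpoch q q m * qpoch q q (Suc k - m)) * f m)"
    unfolding bailey_partial_def sum_distrib_left sum.distrib[symmetric]
    by (intro sum.cong refl *) simp
  have "bailey_partial c f (Suc k)
      = (\<Sum>m\<le>k. (-1) ^ (Suc k - m) * q ^ (Suc (Suc k - m) choose 2) * qpoch q q (Suc k + m + c)
          / (qpoch q q m * qpoch q q (Suc k - m)) * f m)
        + qpoch q q (Suc k + Suc k + c) / qpoch q q (Suc k) * f (Suc k)"
    by (simp add: bailey_partial_def numeral_2_eq_2)
  also have "\<dots> = bailey_partial c f k + (1 - q ^ (2 * Suc k + c)) *
      ((\<Sum>m\<le>k. (-1) ^ (Suc k - m) * q ^ ((Suc k - m) choose 2) * qpoch q q (Suc k + m + c - 1)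
          / (qpoch q q m * qpoch q q (Suc k - m)) * f m)
        + qpoch q q (Suc k + Suc k + c - 1) / qpoch q q (Suc k) * f (Suc k))"
    unfolding S diag distrib_left by (simp add: mult.assoc)
  also have "(\<Sum>m\<le>k. (-1) ^ (Suc k - m) * q ^ ((Suc k - m) choose 2) * qpoch q q (Suc k + m + c - 1)
          / (qpoch q q m * qpoch q q (Suc k - m)) * f m)
        + qpoch q q (Suc k + Suc k + c - 1) / qpoch q q (Suc k) * f (Suc k)
      = (\<Sum>m\<le>Suc k. (-1) ^ (Suc k - m) * q ^ ((Suc k - m) choose 2) * qpoch q q (Suc k + m + c - 1)
          / (qpoch q q m * qpoch q q (Suc k - m)) * f m)"
    by (simp add: numeral_2_eq_2)
  finally show ?thesis
    by (simp only: bailey_sum_def)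
qed

text \<open>The recurrence telescopes and N = 0 fixes the constant. For c = 0 the factor 1 - q^0
  annihilates the term k = 0 while \<open>bailey_partial\<close> starts at 1; this is the separate 1
  in the second identity.\<close>

lemma sum_bailey_sum:
  assumes "c \<le> 1" "f 0 = 1"
  shows "(\<Sum>k\<le>N. bailey_sum c f k) = bailey_partial c f N - of_nat (1 - c)"
proof (induction N)
  case 0
  from assms(1) have "c = 0 \<or> c = 1" by linarith
  then show ?case
    by (auto simp: bailey_sum_def bailey_partial_def assms qpoch_Suc numeral_2_eq_2)
qed (simp add: bailey_partial_Suc)

section \<open>Limits of the partial sums\<close>

lemma tendsto_sum_triangular:
  fixes u :: "nat \<Rightarrow> nat \<Rightarrow> complex"
  assumes bound: "\<And>j k. norm (u j k) \<le> C"
    and lim: "\<And>j. (\<lambda>k. u j k) \<longlonglongrightarrow> L"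
  shows "(\<lambda>k. \<Sum>j\<le>k. (-1) ^ j * q ^ (Suc j choose 2) / qpoch q q j * u j k)
           \<longlonglongrightarrow> (\<Sum>j. (-1) ^ j * q ^ (Suc j choose 2) / qpoch q q j) * L"
proof -
  define t where "t j = (-1) ^ j * q ^ (Suc j choose 2) / qpoch q q j" for j
  \<comment> \<open>As binom(j+1,2) >= j, the weights are dominated by the terms of Euler's series
    at z = q.\<close>
  have norm_t: "norm (t j) \<le> norm (q ^ j / qpoch q q j)" for j
    using norm_q unfolding t_def
    by (auto simp: norm_mult norm_divide norm_power choose_2_Suc intro!: divide_right_mono power_decreasing)
  have sum_t: "summable (\<lambda>j. norm (t j))"
    by (rule summable_comparison_test'[OF summable_norm_power_div_qpoch[OF norm_q(2)]]) (use norm_t in simp)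
  have t: "summable t"
    by (rule summable_norm_cancel[OF sum_t])
  define a where "a j k = (if j \<le> k then t j * u j k else 0)" for j k
  have C: "0 \<le> C"
    using bound[of 0 0] norm_ge_zero order_trans by blast
  have "(\<lambda>k. \<Sum>j. a j k) \<longlonglongrightarrow> (\<Sum>j. t j * L)"
  proof (intro conjunct2[OF conjunct2[OF tannerys_theorem]])
    show "(\<lambda>k. a j k) \<longlonglongrightarrow> t j * L" for j
    proof (rule Lim_transform_eventually)
      show "(\<lambda>k. t j * u j k) \<longlonglongrightarrow> t j * L"
        by (intro tendsto_intros lim)
      show "\<forall>\<^sub>F k in sequentially. t j * u j k = a j k"
        using eventually_ge_at_top[of j] by eventually_elim (simp add: a_def)
    qed
    show "\<forall>\<^sub>F (j, k) in sequentially \<times>\<^sub>F sequentially. norm (a j k) \<le> norm (t j) * C"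
      using C by (intro always_eventually) (auto simp: a_def norm_mult intro: mult_left_mono bound)
    show "summable (\<lambda>j. norm (t j) * C)"
      by (intro summable_mult2 sum_t)
  qed simp
  moreover have "(\<Sum>j. a j k) = (\<Sum>j\<le>k. t j * u j k)" for k
    by (subst suminf_finite[of "{..k}"]) (auto simp: a_def)
  ultimately show "(\<lambda>k. \<Sum>j\<le>k. (-1) ^ j * q ^ (Suc j choose 2) / qpoch q q j * u j k)
           \<longlonglongrightarrow> (\<Sum>j. (-1) ^ j * q ^ (Suc j choose 2) / qpoch q q j) * L"
    unfolding suminf_mult2[OF t, of L, symmetric] unfolding t_def by simp
qed

lemma inverse_qpoch_q_bounded: "\<exists>C>0. \<forall>k. norm (inverse (qpoch q q k)) \<le> C"
proof -
  obtain C where "\<And>k. norm (inverse (qpoch q q k)) \<le> C"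
    using inverse_qpoch_bounded qpoch_q_nonzero by metis
  then show ?thesis
    by (intro exI[of _ "max 1 C"]) (auto simp: le_max_iff_disj)
qed

lemma qpoch_inf_q_nonzero: "qpoch_inf q q \<noteq> 0"
  by (rule qpoch_inf_nonzero) (rule qpoch_q_nonzero)

text \<open>The q-binomial theorem at z = q and length k, with k tending to infinity:
  \<open>u j k\<close> is what the Gaussian binomial has beyond 1/(q)_j, and it tends to 1.\<close>

lemma euler_alternating: "(\<Sum>j. (-1) ^ j * q ^ (Suc j choose 2) / qpoch q q j) = qpoch_inf q q"
proof -
  obtain C where C: "0 < C" "\<And>k. norm (inverse (qpoch q q k)) \<le> C"
    using inverse_qpoch_q_bounded by blast
  define u where "u j k = qpoch q q k / qpoch q q (k - j)" for j k
  have "norm (u j k) \<le> qpoch_bound * C" for j k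
    unfolding u_def divide_inverse norm_mult using norm_q C qpoch_bound_pos
    by (intro mult_mono norm_qpoch_le) auto
  moreover have "(\<lambda>k. u j k) \<longlonglongrightarrow> qpoch_inf q q / qpoch_inf q q" for j
    unfolding u_def
    by (intro tendsto_divide qpoch_LIMSEQ qpoch_inf_q_nonzero
        filterlim_compose[OF qpoch_LIMSEQ filterlim_minus_const_nat_at_top])
  ultimately have "(\<lambda>k. \<Sum>j\<le>k. (-1) ^ j * q ^ (Suc j choose 2) / qpoch q q j * u j k)
      \<longlonglongrightarrow> (\<Sum>j. (-1) ^ j * q ^ (Suc j choose 2) / qpoch q q j) * (qpoch_inf q q / qpoch_inf q q)"
    by (rule tendsto_sum_triangular)
  moreover have "(\<Sum>j\<le>k. (-1) ^ j * q ^ (Suc j choose 2) / qpoch q q j * u j k) = qpoch q q k" for k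
    unfolding qbinomial_theorem[of k q, symmetric]
    by (intro sum.cong) (simp_all add: u_def qbinomial_def choose_2_Suc power_add)
  ultimately show ?thesis
    using LIMSEQ_unique[OF qpoch_LIMSEQ] qpoch_inf_q_nonzero by simp
qed

text \<open>The sum is read from its top end, m = k - j. For fixed j the quotient
  (q)_(2k-j+c)/(q)_(k-j) tends to 1 and ((q)_m)^p to its limit; the remaining weights add up to one
  further (q)_infinity, which makes the exponent p + 1.\<close>

lemma bailey_partial_LIMSEQ: "bailey_partial c (\<lambda>m. qpoch q q m ^ p) \<longlonglongrightarrow> qpoch_inf q q ^ (p + 1)"
proof -
  obtain C where C: "0 < C" "\<And>k. norm (inverse (qpoch q q k)) \<le> C"
    using inverse_qpoch_q_bounded by blast
  define u where "u j k = qpoch q q (k + (k - j) + c) / qpoch q q (k - j) * qpoch q q (k - j) ^ p" for j k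
  have "norm (u j k) \<le> qpoch_bound * C * qpoch_bound ^ p" for j k
    unfolding u_def divide_inverse norm_mult norm_power using norm_q C qpoch_bound_pos
    by (intro mult_mono norm_qpoch_le power_mono) auto
  moreover have "(\<lambda>k. u j k) \<longlonglongrightarrow> qpoch_inf q q / qpoch_inf q q * qpoch_inf q q ^ p" for j
  proof -
    have "filterlim (\<lambda>k. k + (k - j) + c) sequentially sequentially"
      by (rule filterlim_at_top_mono[OF filterlim_ident]) (auto intro: always_eventually)
    then show ?thesis
      unfolding u_def
      by (intro tendsto_intros qpoch_inf_q_nonzero
          filterlim_compose[OF qpoch_LIMSEQ] filterlim_minus_const_nat_at_top)
  qed
  ultimately have "(\<lambda>k. \<Sum>j\<le>k. (-1) ^ j * q ^ (Suc j choose 2) / qpoch q q j * u j k)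
      \<longlonglongrightarrow> (\<Sum>j. (-1) ^ j * q ^ (Suc j choose 2) / qpoch q q j)
        * (qpoch_inf q q / qpoch_inf q q * qpoch_inf q q ^ p)"
    by (rule tendsto_sum_triangular)
  moreover have "(\<Sum>j\<le>k. (-1) ^ j * q ^ (Suc j choose 2) / qpoch q q j * u j k)
      = bailey_partial c (\<lambda>m. qpoch q q m ^ p) k" for k
    unfolding bailey_partial_def
    by (rule sum.reindex_bij_witness[of _ "\<lambda>j. k - j" "\<lambda>j. k - j"]) (auto simp: u_def mult_ac)
  ultimately show ?thesis
    using qpoch_inf_q_nonzero by (simp add: euler_alternating)
qed

lemma bailey_sum_eq_inner_series:
  assumes "c \<le> 1"
  shows "(1 - q ^ (2 * k + c)) * qpoch q q (k + c - 1) * ((-1) ^ k * q ^ (k choose 2) / qpoch q q k)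
           * inner_series p (q ^ (k + c)) k
         = bailey_sum c (\<lambda>m. qpoch q q m ^ p) k"
\<comment> \<open>At k = c = 0 the subtraction in k + c - 1 is truncated, but both sides carry the
  factor 1 - q^0.\<close>
proof (cases "k + c = 0")
  case False
  have *: "qpoch q q (k + c - 1) * ((-1) ^ k * q ^ (k choose 2) / qpoch q q k)
        * (qpoch q (1 / q ^ k) m / qpoch q q m * q ^ m * (qpoch q (q ^ (k + c)) m * qpoch q q m ^ p))
      = (-1) ^ (k - m) * q ^ ((k - m) choose 2) * qpoch q q (k + m + c - 1)
        / (qpoch q q m * qpoch q q (k - m)) * qpoch q q m ^ p" if "m \<le> k" for m
  proof -
    define j where "j = k - m"
    have k: "k = m + j"
      using that by (simp add: j_def)
    have A: "qpoch q q (k + m + c - 1) = qpoch q q (k + c - 1) * qpoch q (q ^ (k + c)) m"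
      using qpoch_add[of q q "k + c - 1" m] False
      by (cases "k + c") (simp_all add: add_ac)
    have B: "qpoch q (1 / q ^ k) m = (-1) ^ m * q ^ (m choose 2) * qpoch q q k / (q ^ (k * m) * qpoch q q (k - m))"
      using qpoch_inverse_power[OF that] by (simp add: eq_divide_eq mult_ac)
    have sgn: "(-1 :: complex) ^ k * (-1) ^ m = (-1) ^ j"
      by (simp add: k power_add mult.commute mult.left_commute flip: power_mult_distrib)
    have "(k choose 2) + (m choose 2) + m = (j choose 2) + k * m"
    proof -
      have "2 * (m choose 2) + m = m * m"
        by (induction m) (simp_all add: choose_2_Suc numeral_2_eq_2)
      then show ?thesis
        by (simp add: k choose_2_add algebra_simps)
    qed
    then have pw: "q ^ (k choose 2) * q ^ (m choose 2) * q ^ m = q ^ (j choose 2) * q ^ (k * m)"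
      by (simp flip: power_add)
    define a b where "a = q ^ (k choose 2)" and "b = q ^ (m choose 2)"
    have "qpoch q q (k + c - 1) * ((-1) ^ k * a / qpoch q q k)
        * ((-1) ^ m * b * qpoch q q k / (q ^ (k * m) * qpoch q q (k - m)) / qpoch q q m * q ^ m * (qpoch q (q ^ (k + c)) m * qpoch q q m ^ p))
      = ((-1) ^ k * (-1) ^ m) * (a * b * q ^ m) / q ^ (k * m) * (qpoch q q (k + c - 1) * qpoch q (q ^ (k + c)) m)
        / (qpoch q q m * qpoch q q (k - m)) * qpoch q q m ^ p"
      by (simp add: mult_ac)
    then show ?thesis
      unfolding A B sgn a_def b_def pw by (simp add: k)
  qed
  show ?thesis
    unfolding inner_series_def bailey_sum_def mult.assoc[of "1 - q ^ (2 * k + c)"] sum_distrib_left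
    using * by (simp add: mult.assoc)
qed (simp add: bailey_sum_def)

end

subsection \<open>Partial fractions\<close>

text \<open>Phrased with the coefficient at \<open>card S\<close> instead of the leading one,
  because some \<open>b s\<close> may vanish: in the application they contain arbitrary
  parameters.\<close>

lemma coeff_prod_linear:
  fixes y :: "'i \<Rightarrow> 'a :: comm_ring_1"
  assumes "finite S"
  shows "degree (\<Prod>s\<in>S. [:a s, b s:]) \<le> card S \<and> coeff (\<Prod>s\<in>S. [:a s, b s:]) (card S) = (\<Prod>s\<in>S. b s)"
  using assms
proof (induction S rule: finite_induct)
  case (insert r S)
  define P where "P = (\<Prod>s\<in>S. [:a s, b s:])"
  have P: "degree P \<le> card S" "coeff P (card S) = (\<Prod>s\<in>S. b s)"
    using insert.IH by (simp_all add: P_def)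
  have deg: "degree ([:a r, b r:] * P) \<le> Suc (card S)"
    using degree_mult_le[of "[:a r, b r:]" P] P(1) by (auto split: if_splits)
  have "coeff P (Suc (card S)) = 0"
    using P(1) by (simp add: coeff_eq_0)
  then show ?case
    using insert.hyps deg P by (simp flip: P_def)
qed simp

text \<open>Lagrange interpolation of \<open>P\<close> at the points \<open>y r\<close>, evaluated at \<open>0\<close>.\<close>
lemma sum_poly_partial_fraction:
  fixes P :: "'a :: field poly"
  assumes S: "finite S" and inj: "inj_on y S" and nz: "\<And>s. s \<in> S \<Longrightarrow> y s \<noteq> 0"
    and deg: "degree P \<le> card S"
  shows "(\<Sum>r\<in>S. poly P (y r) / (\<Prod>s\<in>S - {r}. 1 - y r / y s))
           = poly P 0 - coeff P (card S) * (\<Prod>s\<in>S. - y s)"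
proof -
  define W where "W = (\<Prod>s\<in>S. [:- y s, 1:])"
  define L where "L r = (\<Prod>s\<in>S - {r}. [:- y s, 1:])" for r
  \<comment> \<open>Lagrange interpolation handles degrees below \<open>card S\<close>. The multiple
    of \<open>W\<close>, which vanishes at every node, removes the top coefficient, so
    \<open>R\<close> has too many zeros for its degree.\<close>
  define R where "R = P - smult (coeff P (card S)) W
    - (\<Sum>r\<in>S. smult (poly P (y r) / (\<Prod>s\<in>S - {r}. y r - y s)) (L r))"
  have W: "degree W \<le> card S" "coeff W (card S) = 1"
    using coeff_prod_linear[OF S, of "\<lambda>s. - y s" "\<lambda>_. 1"] by (simp_all add: W_def)
  have L: "coeff (L r) i = 0" if "r \<in> S" "card S \<le> i" for r i
  proof (rule coeff_eq_0)
    have "degree (L r) \<le> card (S - {r})"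
      using coeff_prod_linear[of "S - {r}" "\<lambda>s. - y s" "\<lambda>_. 1"] S by (simp add: L_def)
    moreover have "card (S - {r}) < card S"
      using S that by (intro card_Diff1_less)
    ultimately show "degree (L r) < i"
      using that by simp
  qed
  have "R = 0"
  proof (rule ccontr)
    assume R0: "R \<noteq> 0"
    have coeff_R: "coeff R i = 0" if "card S \<le> i" for i
    proof (cases "i = card S")
      case False
      then have "coeff P i = 0" "coeff W i = 0"
        using that deg W by (simp_all add: coeff_eq_0)
      then show ?thesis
        using that by (simp add: R_def coeff_sum L)
    qed (simp add: R_def coeff_sum L W)
    have "degree R < card S"
      using R0 coeff_R[of "degree R"] by (metis leading_coeff_0_iff not_le)
    moreover have "y ` S \<subseteq> {t. poly R t = 0}"
    proof clarify
      fix r assume r: "r \<in> S"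
      have "poly W (y r) = 0"
        using r S by (auto simp: W_def poly_prod)
      moreover have "poly (L r') (y r) = (if r' = r then (\<Prod>s\<in>S - {r}. y r - y s) else 0)"
        if "r' \<in> S" for r'
        using r that S by (auto simp: L_def poly_prod)
      then have "(\<Sum>r'\<in>S. poly P (y r') / (\<Prod>s\<in>S - {r'}. y r' - y s) * poly (L r') (y r))
          = (\<Sum>r'\<in>S. if r' = r then poly P (y r) / (\<Prod>s\<in>S - {r}. y r - y s) * (\<Prod>s\<in>S - {r}. y r - y s) else 0)"
        by (intro sum.cong) auto
      then have "(\<Sum>r'\<in>S. poly P (y r') / (\<Prod>s\<in>S - {r'}. y r' - y s) * poly (L r') (y r))
          = poly P (y r)"
        using r S inj by (auto simp: inj_on_def)
      ultimately show "poly R (y r) = 0"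
        by (simp add: R_def poly_sum)
    qed
    then have "card S \<le> card {t. poly R t = 0}"
      using card_mono[OF poly_roots_finite[OF R0]] card_image[OF inj] by metis
    ultimately show False
      using card_poly_roots_bound[OF R0] by simp
  qed
  then have "0 = poly R 0"
    by simp
  also have "poly R 0 = poly P 0 - coeff P (card S) * (\<Prod>s\<in>S. - y s)
      - (\<Sum>r\<in>S. poly P (y r) / (\<Prod>s\<in>S - {r}. y r - y s) * (\<Prod>s\<in>S - {r}. - y s))"
    by (simp add: R_def poly_sum W_def L_def poly_prod)
  also have "(\<Sum>r\<in>S. poly P (y r) / (\<Prod>s\<in>S - {r}. y r - y s) * (\<Prod>s\<in>S - {r}. - y s))
      = (\<Sum>r\<in>S. poly P (y r) / (\<Prod>s\<in>S - {r}. 1 - y r / y s))"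
  proof (rule sum.cong[OF refl])
    fix r assume r: "r \<in> S"
    have "(\<Prod>s\<in>S - {r}. y r - y s) = (\<Prod>s\<in>S - {r}. (1 - y r / y s) * (- y s))"
      using nz by (intro prod.cong) (auto simp: field_simps)
    then have "(\<Prod>s\<in>S - {r}. y r - y s) = (\<Prod>s\<in>S - {r}. 1 - y r / y s) * (\<Prod>s\<in>S - {r}. - y s)"
      by (simp only: prod.distrib)
    moreover have "(\<Prod>s\<in>S - {r}. - y s) \<noteq> 0"
      using S nz by simp
    ultimately show "poly P (y r) / (\<Prod>s\<in>S - {r}. y r - y s) * (\<Prod>s\<in>S - {r}. - y s)
        = poly P (y r) / (\<Prod>s\<in>S - {r}. 1 - y r / y s)"
      by simp
  qed
  finally show ?thesis
    by (simp add: algebra_simps)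
qed

text \<open>Take for P the product of the polynomials u - (a s / y s) t in t: its value at 0 is a
  power of u, and in its top coefficient the \<open>y s\<close> cancel.\<close>

lemma sum_linear_partial_fraction:
  fixes y :: "'i \<Rightarrow> 'a :: field"
  assumes S: "finite S" and inj: "inj_on y S" and nz: "\<And>s. s \<in> S \<Longrightarrow> y s \<noteq> 0"
  shows "(\<Sum>r\<in>S. (\<Prod>s\<in>S. u - a s * y r / y s) / (\<Prod>s\<in>S - {r}. 1 - y r / y s))
           = u ^ card S - (\<Prod>s\<in>S. a s)"
proof -
  define P where "P = (\<Prod>s\<in>S. [:u, - a s / y s:])"
  have P: "degree P \<le> card S" "coeff P (card S) = (\<Prod>s\<in>S. - a s / y s)"
    using coeff_prod_linear[OF S, of "\<lambda>_. u" "\<lambda>s. - a s / y s"] by (simp_all add: P_def)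
  have "coeff P (card S) * (\<Prod>s\<in>S. - y s) = (\<Prod>s\<in>S. a s)"
    unfolding P prod.distrib[symmetric] using nz by (intro prod.cong) auto
  then show ?thesis
    using sum_poly_partial_fraction[OF S inj nz P(1)] by (simp add: P_def poly_prod mult.commute)
qed

subsection \<open>Milne's fundamental theorem\<close>

text \<open>Every index other than t lies in exactly one ordered pair with t, so it contributes one
  factor \<open>c s\<close>, on whichever side of t it falls.\<close>

lemma prod_pairs_change:
  fixes f g :: "nat \<Rightarrow> nat \<Rightarrow> 'a :: comm_monoid_mult"
  assumes t: "t \<in> {1..n}"
    and g: "\<And>r s. r \<in> {1..n} \<Longrightarrow> s \<in> {r<..n} \<Longrightarrow>
              g r s = f r s * ((if r = t then c s else 1) * (if s = t then c r else 1))"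
  shows "(\<Prod>r\<in>{1..n}. \<Prod>s\<in>{r<..n}. g r s)
           = (\<Prod>r\<in>{1..n}. \<Prod>s\<in>{r<..n}. f r s) * (\<Prod>s\<in>{1..n} - {t}. c s)"
proof -
  have "(\<Prod>r\<in>{1..n}. \<Prod>s\<in>{r<..n}. if r = t then c s else 1)
      = (\<Prod>r\<in>{1..n}. if r = t then \<Prod>s\<in>{r<..n}. c s else 1)"
    by (intro prod.cong) auto
  also have "\<dots> = (\<Prod>s\<in>{t<..n}. c s)"
    using t by simp
  finally have 1: "(\<Prod>r\<in>{1..n}. \<Prod>s\<in>{r<..n}. if r = t then c s else 1) = (\<Prod>s\<in>{t<..n}. c s)" .
  have "(\<Prod>r\<in>{1..n}. \<Prod>s\<in>{r<..n}. if s = t then c r else 1)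
      = (\<Prod>r\<in>{1..n}. if r < t then c r else 1)"
    using t by (intro prod.cong) auto
  also have "\<dots> = (\<Prod>s\<in>{1..<t}. c s)"
    using t by (subst prod.inter_filter[symmetric]) (auto intro!: prod.cong)
  finally have 2: "(\<Prod>r\<in>{1..n}. \<Prod>s\<in>{r<..n}. if s = t then c r else 1) = (\<Prod>s\<in>{1..<t}. c s)" .
  have "{1..n} - {t} = {t<..n} \<union> {1..<t}"
    using t by auto
  then have 3: "(\<Prod>s\<in>{1..n} - {t}. c s) = (\<Prod>s\<in>{t<..n}. c s) * (\<Prod>s\<in>{1..<t}. c s)"
    by (simp add: prod.union_disjoint Int_def)
  have "(\<Prod>r\<in>{1..n}. \<Prod>s\<in>{r<..n}. g r s) = (\<Prod>r\<in>{1..n}. \<Prod>s\<in>{r<..n}. f r s * ((if r = t then c s else 1) * (if s = t then c r else 1)))"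
    by (intro prod.cong g refl)
  then show ?thesis
    by (simp only: prod.distrib 1 2 3)
qed

section \<open>Multi-indices of fixed size\<close>

definition multi_indices_size :: "nat \<Rightarrow> nat \<Rightarrow> (nat \<Rightarrow> nat) set" where
  "multi_indices_size n M = {m \<in> multi_indices n. msize n m = M}"

lemma finite_multi_indices_size: "finite (multi_indices_size n M)"
proof (rule finite_subset)
  show "multi_indices_size n M \<subseteq> (\<Pi>\<^sub>E r\<in>{1..n}. {0..M})"
  proof
    fix m assume m: "m \<in> multi_indices_size n M"
    have "m r \<le> M" if "r \<in> {1..n}" for r
      using m that member_le_sum[of r "{1..n}" m] by (simp add: multi_indices_size_def msize_def)
    then show "m \<in> (\<Pi>\<^sub>E r\<in>{1..n}. {0..M})"
      using m by (auto simp: multi_indices_size_def multi_indices_def PiE_iff)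
  qed
qed (auto intro!: finite_PiE)

lemma multi_indices_size_0: "multi_indices_size n 0 = {\<lambda>r\<in>{1..n}. 0}"
  by (auto simp: multi_indices_size_def multi_indices_def msize_def restrict_def PiE_iff extensional_def fun_eq_iff)

lemma msize_upd: "r \<in> {1..n} \<Longrightarrow> msize n (m(r := j)) + m r = msize n m + j"
proof -
  assume r: "r \<in> {1..n}"
  have "(\<Sum>s\<in>{1..n} - {r}. (m(r := j)) s) = (\<Sum>s\<in>{1..n} - {r}. m s)"
    by (intro sum.cong) auto
  then show ?thesis
    using sum.remove[OF finite_atLeastAtMost r, of m] sum.remove[OF finite_atLeastAtMost r, of "m(r := j)"]
    unfolding msize_def by (simp del: fun_upd_apply add: fun_upd_same)
qed

text \<open>Taking one unit away from entry r matches the pairs (m, r) of size M + 1 with m r > 0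
  with all pairs of size M; \<open>f0\<close> disposes of the remaining ones.\<close>

lemma sum_multi_indices_size_Suc:
  fixes f :: "(nat \<Rightarrow> nat) \<Rightarrow> nat \<Rightarrow> 'a :: comm_monoid_add"
  assumes f0: "\<And>m r. r \<in> {1..n} \<Longrightarrow> m r = 0 \<Longrightarrow> f m r = 0"
  shows "(\<Sum>m\<in>multi_indices_size n (Suc M). \<Sum>r\<in>{1..n}. f m r)
           = (\<Sum>m\<in>multi_indices_size n M. \<Sum>r\<in>{1..n}. f (m(r := Suc (m r))) r)"
proof -
  have "(\<Sum>m\<in>multi_indices_size n (Suc M). \<Sum>r\<in>{1..n}. f m r)
      = (\<Sum>(m, r)\<in>multi_indices_size n (Suc M) \<times> {1..n}. f m r)"
    by (intro sum.cartesian_product)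
  also have "\<dots> = (\<Sum>(m, r)\<in>{(m, r) \<in> multi_indices_size n (Suc M) \<times> {1..n}. 0 < m r}. f m r)"
    by (rule sum.mono_neutral_right) (auto intro!: finite_multi_indices_size f0)
  also have "\<dots> = (\<Sum>(m, r)\<in>multi_indices_size n M \<times> {1..n}. f (m(r := Suc (m r))) r)"
  proof (rule sum.reindex_bij_witness[of _ "\<lambda>(m, r). (m(r := Suc (m r)), r)" "\<lambda>(m, r). (m(r := m r - 1), r)"])
    fix p assume "p \<in> {(m, r) \<in> multi_indices_size n (Suc M) \<times> {1..n}. 0 < m r}"
    moreover obtain m r where p: "p = (m, r)" by fastforce
    ultimately have *: "m \<in> multi_indices n" "msize n m = Suc M" "r \<in> {1..n}" "0 < m r"
      by (auto simp: multi_indices_size_def)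
    then have "msize n (m(r := m r - 1)) = M"
      using msize_upd[of r n m "m r - 1"] by simp
    then show "(case p of (m, r) \<Rightarrow> (m(r := m r - 1), r)) \<in> multi_indices_size n M \<times> {1..n}"
      using * by (auto simp: p multi_indices_size_def multi_indices_def PiE_iff extensional_def)
  next
    fix p assume "p \<in> multi_indices_size n M \<times> {1..n}"
    moreover obtain m r where p: "p = (m, r)" by fastforce
    ultimately have *: "m \<in> multi_indices n" "msize n m = M" "r \<in> {1..n}"
      by (auto simp: multi_indices_size_def)
    then have "msize n (m(r := Suc (m r))) = Suc M"
      using msize_upd[of r n m "Suc (m r)"] by simp
    then show "(case p of (m, r) \<Rightarrow> (m(r := Suc (m r)), r))
        \<in> {(m, r) \<in> multi_indices_size n (Suc M) \<times> {1..n}. 0 < m r}"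
      using * by (auto simp: p multi_indices_size_def multi_indices_def PiE_iff extensional_def)
  qed auto
  also have "\<dots> = (\<Sum>m\<in>multi_indices_size n M. \<Sum>r\<in>{1..n}. f (m(r := Suc (m r))) r)"
    by (intro sum.cartesian_product[symmetric])
  finally show ?thesis .
qed

text \<open>Quotient of the Vandermonde products at the points x_r q^(m_r) and x_r. Free of the
  negative powers of q in \<open>vandermonde_quot\<close>, it stays bounded in m.\<close>

definition vandermonde_ratio :: "nat \<Rightarrow> complex \<Rightarrow> (nat \<Rightarrow> complex) \<Rightarrow> (nat \<Rightarrow> nat) \<Rightarrow> complex" where
  "vandermonde_ratio n q x m =
     (\<Prod>r\<in>{1..n}. \<Prod>s\<in>{r<..n}. (x r * q ^ m r - x s * q ^ m s) / (x r - x s))"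

text \<open>
  The parameter \<open>u\<close> homogenises the summand: \<open>u = 1\<close> gives the usual \<open>q\<close>-Pochhammer symbols, while
  \<open>u = 0\<close> gives the confluent limit in which all \<open>a s\<close> tend to infinity.
\<close>

definition milne_term ::
  "nat \<Rightarrow> complex \<Rightarrow> (nat \<Rightarrow> complex) \<Rightarrow> complex \<Rightarrow> (nat \<Rightarrow> complex) \<Rightarrow> (nat \<Rightarrow> nat) \<Rightarrow> complex" where
  "milne_term n q x u a m = vandermonde_ratio n q x m *
     (\<Prod>r\<in>{1..n}. \<Prod>s\<in>{1..n}. (\<Prod>i<m r. u - a s * q ^ i * x r / x s) / qpoch q (q * x r / x s) (m r))"

context
  fixes q :: complex and n :: nat and x :: "nat \<Rightarrow> complex"
  assumes norm_q: "0 < norm q" "norm q < 1"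
    and x_nonzero: "\<And>r. r \<in> {1..n} \<Longrightarrow> x r \<noteq> 0"
    and x_distinct: "\<And>r s. \<lbrakk>1 \<le> r; r < s; s \<le> n\<rbrakk> \<Longrightarrow> 1 - x r / x s \<noteq> 0"
    and x_qpoch: "\<And>r s j. \<lbrakk>r \<in> {1..n}; s \<in> {1..n}\<rbrakk> \<Longrightarrow> qpoch q (q * x r / x s) j \<noteq> 0"
begin

text \<open>Equality with i > j would make a factor of \<open>qpoch q (q * x r / x s)\<close>
  vanish, and i = j would kill a Vandermonde denominator. Hence the interpolation nodes x_r q^(m_r)
  are distinct.\<close>

lemma x_generic:
  assumes "r \<in> {1..n}" "s \<in> {1..n}" "r \<noteq> s"
  shows "x r * q ^ i \<noteq> x s * q ^ j"
proof
  have less: False if rs: "r \<in> {1..n}" "s \<in> {1..n}" and ij: "j < i" and eq: "x r * q ^ i = x s * q ^ j" for r s i j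
  proof -
    from ij obtain d where d: "i = j + Suc d"
      by (metis add_Suc_right less_imp_Suc_add)
    have "q * x r / x s * q ^ d = 1"
      using eq q_nonzero[OF norm_q] x_nonzero[OF rs(2)] by (simp add: d power_add field_simps)
    then have "qpoch q (q * x r / x s) (Suc d) = 0"
      unfolding qpoch_eq_0_iff by blast
    then show False
      using x_qpoch[OF rs] by blast
  qed
  assume eq: "x r * q ^ i = x s * q ^ j"
  consider "j < i" | "i < j" | "i = j" by linarith
  then show False
  proof cases
    case 3
    then have "x r = x s"
      using eq q_nonzero[OF norm_q] by simp
    then show False
      using x_distinct[of r s] x_distinct[of s r] x_nonzero[of r] x_nonzero[of s] assms
      by (cases "r < s") auto
  qed (use less[of r s j i] less[of s r i j] assms eq in auto)
qed

lemma vandermonde_ratio_upd: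
  assumes t: "t \<in> {1..n}"
  shows "vandermonde_ratio n q x (m(t := Suc (m t))) = vandermonde_ratio n q x m *
    (\<Prod>s\<in>{1..n} - {t}. (q * (x t * q ^ m t) - x s * q ^ m s) / (x t * q ^ m t - x s * q ^ m s))"
  unfolding vandermonde_ratio_def
proof (rule prod_pairs_change[OF t])
  fix r s assume rs: "r \<in> {1..n}" "s \<in> {r<..n}"
  define y where "y r = x r * q ^ m r" for r
  have ne: "y r \<noteq> y s" "y s \<noteq> y r" "x r \<noteq> x s"
    using rs x_generic[of r s "m r" "m s"] x_generic[of r s 0 0] by (auto simp: y_def)
  have "(x r * q ^ (m(t := Suc (m t))) r - x s * q ^ (m(t := Suc (m t))) s)
      = ((if r = t then q * y r else y r) - (if s = t then q * y s else y s))"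
    by (simp add: y_def)
  also have "\<dots> = (y r - y s) * ((if r = t then (q * y t - y s) / (y t - y s) else 1) *
      (if s = t then (q * y t - y r) / (y t - y r) else 1))"
  proof -
    \<comment> \<open>A pair with t in second place yields the same factor as one with t in first
      place: numerator and denominator both change sign.\<close>
    have "y r - q * y s = (y r - y s) * ((q * y s - y r) / (y s - y r))"
      using ne by (simp add: field_simps)
    note e = this
    show ?thesis
    proof (cases "s = t")
      case True
      then have "r \<noteq> t"
        using rs by auto
      then show ?thesis
        using e True by (simp only: simp_thms if_True if_False mult_1_left)
    next
      case False
      then show ?thesis
        using ne False by (cases "r = t") simp_all
    qed
  qed
  finally show "(x r * q ^ (m(t := Suc (m t))) r - x s * q ^ (m(t := Suc (m t))) s) / (x r - x s) =
      (x r * q ^ m r - x s * q ^ m s) / (x r - x s) *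
      ((if r = t then (q * (x t * q ^ m t) - x s * q ^ m s) / (x t * q ^ m t - x s * q ^ m s) else 1) *
       (if s = t then (q * (x t * q ^ m t) - x r * q ^ m r) / (x t * q ^ m t - x r * q ^ m r) else 1))"
    by (simp add: y_def)
qed

text \<open>The Vandermonde gain (q y_t - y_s)/(y_t - y_s) is just what turns the partial-fraction
  denominators 1 - q y_t/y_s of the raised index into 1 - y_t/y_s; the Pochhammer part exchanges the
  numerators.\<close>

lemma milne_term_upd:
  fixes m :: "nat \<Rightarrow> nat"
  assumes t: "t \<in> {1..n}"
  defines "y \<equiv> \<lambda>r. x r * q ^ m r"
  shows "milne_term n q x u a (m(t := Suc (m t))) *
      ((\<Prod>s\<in>{1..n}. 1 - q * y t / x s) / (\<Prod>s\<in>{1..n} - {t}. 1 - q * y t / y s))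
    = milne_term n q x u a m *
      ((\<Prod>s\<in>{1..n}. u - a s * y t / x s) / (\<Prod>s\<in>{1..n} - {t}. 1 - y t / y s))"
proof -
  define N where "N r k = (\<Prod>s\<in>{1..n}. (\<Prod>i<k. u - a s * q ^ i * x r / x s) / qpoch q (q * x r / x s) k)" for r k
  have nz: "1 - q * y t / x s \<noteq> 0" if "s \<in> {1..n}" for s
    using x_qpoch[OF t that, of "Suc (m t)"] by (simp add: qpoch_Suc y_def mult.assoc)
  have N_Suc: "N t (Suc (m t)) = N t (m t) * ((\<Prod>s\<in>{1..n}. u - a s * y t / x s) / (\<Prod>s\<in>{1..n}. 1 - q * y t / x s))"
    by (simp add: N_def qpoch_Suc y_def prod.distrib[symmetric] prod_dividef[symmetric] mult_ac)
  have N_prod: "(\<Prod>r\<in>{1..n}. N r ((m(t := Suc (m t))) r))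
      = (\<Prod>r\<in>{1..n}. N r (m r)) * ((\<Prod>s\<in>{1..n}. u - a s * y t / x s) / (\<Prod>s\<in>{1..n}. 1 - q * y t / x s))"
  proof -
    have "(\<Prod>r\<in>{1..n} - {t}. N r ((m(t := Suc (m t))) r)) = (\<Prod>r\<in>{1..n} - {t}. N r (m r))"
      by (intro prod.cong) auto
    then have "(\<Prod>r\<in>{1..n}. N r ((m(t := Suc (m t))) r)) = N t (Suc (m t)) * (\<Prod>r\<in>{1..n} - {t}. N r (m r))"
      by (simp only: prod.remove[OF finite_atLeastAtMost t] fun_upd_same)
    moreover have "(\<Prod>r\<in>{1..n}. N r (m r)) = N t (m t) * (\<Prod>r\<in>{1..n} - {t}. N r (m r))"
      by (rule prod.remove[OF finite_atLeastAtMost t])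
    ultimately show ?thesis
      unfolding N_Suc by (simp only: mult_ac)
  qed
  have "(\<Prod>s\<in>{1..n} - {t}. (q * y t - y s) / (y t - y s)) / (\<Prod>s\<in>{1..n} - {t}. 1 - q * y t / y s)
      = (\<Prod>s\<in>{1..n} - {t}. 1 / (1 - y t / y s))"
    unfolding prod_dividef[symmetric]
  proof (rule prod.cong[OF refl])
    fix s assume s: "s \<in> {1..n} - {t}"
    have "y s \<noteq> 0"
      using s x_nonzero norm_q by (auto simp: y_def)
    moreover have "y t \<noteq> y s" "q * y t \<noteq> y s"
      using s t x_generic[of t s "m t" "m s"] x_generic[of t s "Suc (m t)" "m s"] by (auto simp: y_def mult_ac)
    ultimately show "(q * y t - y s) / (y t - y s) / (1 - q * y t / y s) = 1 / (1 - y t / y s)"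
      by (simp add: divide_simps) (simp add: algebra_simps)?
  qed
  then have V: "(\<Prod>s\<in>{1..n} - {t}. (q * y t - y s) / (y t - y s)) / (\<Prod>s\<in>{1..n} - {t}. 1 - q * y t / y s)
      = 1 / (\<Prod>s\<in>{1..n} - {t}. 1 - y t / y s)"
    by (simp add: prod_dividef)
  define A B C D E F G where defs: "A = vandermonde_ratio n q x m" "B = (\<Prod>r\<in>{1..n}. N r (m r))"
    "C = (\<Prod>s\<in>{1..n}. u - a s * y t / x s)" "D = (\<Prod>s\<in>{1..n}. 1 - q * y t / x s)"
    "E = (\<Prod>s\<in>{1..n} - {t}. (q * y t - y s) / (y t - y s))" "F = (\<Prod>s\<in>{1..n} - {t}. 1 - q * y t / y s)"
    "G = (\<Prod>s\<in>{1..n} - {t}. 1 - y t / y s)"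
  have "D \<noteq> 0"
    using nz by (simp add: defs)
  have "milne_term n q x u a (m(t := Suc (m t))) = A * E * (B * (C / D))"
    unfolding milne_term_def vandermonde_ratio_upd[OF t] N_def[symmetric] N_prod by (simp add: defs y_def)
  moreover have "milne_term n q x u a m = A * B"
    by (simp add: milne_term_def defs N_def)
  moreover have "A * E * (B * (C / D)) * (D / F) = A * B * (C / G)"
  proof -
    have "A * E * (B * (C / D)) * (D / F) = A * B * C * (E / F)"
      using \<open>D \<noteq> 0\<close> by simp
    also have "E / F = 1 / G"
      using V by (simp add: defs)
    finally show ?thesis
      by simp
  qed
  ultimately show ?thesis
    by (simp add: defs)
qed

text \<open>
  Both \<open>1 - q ^ Suc M\<close> and \<open>u ^ n - q ^ M * \<Prod>a\<close> are expanded in partial fractions at the points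
  \<open>x r * q ^ m r\<close>; the \<open>r\<close>-th fractions match under raising \<open>m r\<close> by one.
\<close>

lemma milne_theorem:
  "(\<Sum>m\<in>multi_indices_size n M. milne_term n q x u a m)
     = (\<Prod>i<M. u ^ n - q ^ i * (\<Prod>s\<in>{1..n}. a s)) / qpoch q q M"
proof (induction M)
  case 0
  define z :: "nat \<Rightarrow> nat" where "z = (\<lambda>r\<in>{1..n}. 0)"
  have z: "z r = 0" if "r \<in> {1..n}" for r
    using that by (simp add: z_def)
  then have "vandermonde_ratio n q x z = 1"
    unfolding vandermonde_ratio_def using x_generic[of _ _ 0 0] by (intro prod.neutral ballI) auto
  then show ?case
    unfolding multi_indices_size_0 z_def[symmetric] by (simp add: milne_term_def z)
next
  case (Suc M)
  define y where "y m r = x r * q ^ m r" for m r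
  define h where "h m r = (\<Prod>s\<in>{1..n}. 1 - y m r / x s) / (\<Prod>s\<in>{1..n} - {r}. 1 - y m r / y m s)" for m r
  define g where "g m r = (\<Prod>s\<in>{1..n}. u - a s * y m r / x s) / (\<Prod>s\<in>{1..n} - {r}. 1 - y m r / y m s)" for m r
  define T where "T = milne_term n q x u a"
  \<comment> \<open>Interpolating with b_s q^(m_s) in place of b_s changes y_s into x_s in the
    numerators and puts q^|m| on the right.\<close>
  have partial_fractions: "(\<Sum>r\<in>{1..n}. (\<Prod>s\<in>{1..n}. v - b s * y m r / x s) / (\<Prod>s\<in>{1..n} - {r}. 1 - y m r / y m s))
      = v ^ n - q ^ msize n m * (\<Prod>s\<in>{1..n}. b s)" for v b m
  proof -
    have "(\<Sum>r\<in>{1..n}. (\<Prod>s\<in>{1..n}. v - b s * q ^ m s * y m r / y m s) / (\<Prod>s\<in>{1..n} - {r}. 1 - y m r / y m s))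
        = v ^ card {1..n} - (\<Prod>s\<in>{1..n}. b s * q ^ m s)"
    proof (rule sum_linear_partial_fraction)
      show "inj_on (y m) {1..n}"
        unfolding y_def by (intro inj_onI) (metis x_generic)
      show "y m s \<noteq> 0" if "s \<in> {1..n}" for s
        using that x_nonzero q_nonzero[OF norm_q] by (simp add: y_def)
    qed simp
    moreover have "b s * q ^ m s * y m r / y m s = b s * y m r / x s" for r s
      using q_nonzero[OF norm_q] by (simp add: y_def)
    ultimately show ?thesis
      by (simp add: prod.distrib msize_def power_sum mult.commute)
  qed
  have h: "(\<Sum>r\<in>{1..n}. h m r) = 1 - q ^ msize n m" for m
    using partial_fractions[where v = 1 and b = "\<lambda>_. 1"] by (simp add: h_def)
  have g: "(\<Sum>r\<in>{1..n}. g m r) = u ^ n - q ^ msize n m * (\<Prod>s\<in>{1..n}. a s)" for m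
    using partial_fractions by (simp add: g_def)
  \<comment> \<open>The factor s = r is 1 - x_r/x_r; this is the vanishing that the reindexing asks
    for.\<close>
  have h0: "h m r = 0" if "r \<in> {1..n}" "m r = 0" for m r
    using that x_nonzero by (auto simp: h_def y_def)
  have upd: "T (m(r := Suc (m r))) * h (m(r := Suc (m r))) r = T m * g m r" if r: "r \<in> {1..n}" for m r
  proof -
    have "y (m(r := Suc (m r))) r = q * y m r" 
      by (simp add: y_def)
    moreover have "(\<Prod>s\<in>{1..n} - {r}. 1 - q * y m r / y (m(r := Suc (m r))) s) = (\<Prod>s\<in>{1..n} - {r}. 1 - q * y m r / y m s)"
      by (intro prod.cong) (auto simp: y_def)
    ultimately show ?thesis
      using milne_term_upd[OF r, of u a m, folded y_def] by (simp only: T_def h_def g_def)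
  qed
  have size: "msize n m = M" if "m \<in> multi_indices_size n M" for m M
    using that by (simp add: multi_indices_size_def)
  have "(1 - q ^ Suc M) * (\<Sum>m\<in>multi_indices_size n (Suc M). T m)
      = (\<Sum>m\<in>multi_indices_size n (Suc M). \<Sum>r\<in>{1..n}. T m * h m r)"
    unfolding sum_distrib_left[of _ _ "multi_indices_size n (Suc M)"]
    by (intro sum.cong refl) (simp only: sum_distrib_left[symmetric] h size mult.commute)
  also have "\<dots> = (\<Sum>m\<in>multi_indices_size n M. \<Sum>r\<in>{1..n}. T (m(r := Suc (m r))) * h (m(r := Suc (m r))) r)"
    by (rule sum_multi_indices_size_Suc) (simp add: h0)
  also have "\<dots> = (\<Sum>m\<in>multi_indices_size n M. \<Sum>r\<in>{1..n}. T m * g m r)"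
    by (intro sum.cong refl upd)
  also have "\<dots> = (u ^ n - q ^ M * (\<Prod>s\<in>{1..n}. a s)) * (\<Sum>m\<in>multi_indices_size n M. T m)"
    unfolding sum_distrib_left[of _ _ "multi_indices_size n M"]
    by (intro sum.cong refl) (simp only: sum_distrib_left[symmetric] g size mult.commute)
  finally have "(\<Sum>m\<in>multi_indices_size n (Suc M). T m)
      = (u ^ n - q ^ M * (\<Prod>s\<in>{1..n}. a s)) * (\<Sum>m\<in>multi_indices_size n M. T m) / (1 - q ^ Suc M)"
    using q_power_neq_1[OF norm_q, of "Suc M"] by (simp add: field_simps)
  then show ?case
    using Suc by (simp add: T_def qpoch_Suc mult_ac)
qed

end

subsection \<open>Reduction to one dimension\<close>

lemma prod_neg_geometric:
  fixes q z :: "'a :: comm_ring_1"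
  shows "(\<Prod>i<k. - (q ^ i * z)) = (-1) ^ k * q ^ (k choose 2) * z ^ k"
  by (induction k) (simp_all add: choose_2_Suc power_add numeral_2_eq_2)

lemma sum_pairs_snd:
  fixes m :: "nat \<Rightarrow> nat"
  shows "(\<Sum>r\<in>{1..n}. \<Sum>s\<in>{r<..n}. m s) = (\<Sum>s\<in>{1..n}. (s - 1) * m s)"
proof (induction n)
  case (Suc n)
  have "{r<..Suc n} = insert (Suc n) {r<..n}" if "r \<in> {1..n}" for r
    using that by auto
  then have "(\<Sum>r\<in>{1..n}. \<Sum>s\<in>{r<..Suc n}. m s) = (\<Sum>r\<in>{1..n}. m (Suc n) + (\<Sum>s\<in>{r<..n}. m s))"
    by (intro sum.cong) simp_all
  then show ?case
    using Suc by (simp add: sum.distrib)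
qed simp

context
  fixes q :: complex and n :: nat and x :: "nat \<Rightarrow> complex"
  assumes norm_q: "0 < norm q" "norm q < 1"
    and n: "n \<ge> 1"
    and x_nonzero: "\<And>r. r \<in> {1..n} \<Longrightarrow> x r \<noteq> 0"
    and x_distinct: "\<And>r s. \<lbrakk>1 \<le> r; r < s; s \<le> n\<rbrakk> \<Longrightarrow> 1 - x r / x s \<noteq> 0"
    and x_qpoch: "\<And>r s j. \<lbrakk>r \<in> {1..n}; s \<in> {1..n}\<rbrakk> \<Longrightarrow> qpoch q (q * x r / x s) j \<noteq> 0"
begin

text \<open>Each pair r < s takes up a factor q^(m_s); s is the larger index of s - 1 pairs, whence
  the weights r - 1.\<close>

lemma vandermonde_quot_eq:
  "vandermonde_quot n q x m * q ^ (\<Sum>r=1..n. (r - 1) * m r) = vandermonde_ratio n q x m"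
proof -
  have "q ^ (\<Sum>r=1..n. (r - 1) * m r) = (\<Prod>r\<in>{1..n}. \<Prod>s\<in>{r<..n}. q ^ m s)"
    by (simp only: sum_pairs_snd[symmetric] power_sum)
  then have "vandermonde_quot n q x m * q ^ (\<Sum>r=1..n. (r - 1) * m r)
      = (\<Prod>r\<in>{1..n}. \<Prod>s\<in>{r<..n}. (1 - q powi (int (m r) - int (m s)) * x r / x s) / (1 - x r / x s) * q ^ m s)"
    unfolding vandermonde_quot_def by (simp only: prod.distrib)
  also have "\<dots> = vandermonde_ratio n q x m"
    unfolding vandermonde_ratio_def
  proof (intro prod.cong refl)
    fix r s assume rs: "r \<in> {1..n}" "s \<in> {r<..n}"
    then have nz: "x s \<noteq> 0" "1 - x r / x s \<noteq> 0"
      using x_nonzero x_distinct by auto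
    define N d where "N = x r * q ^ m r - x s * q ^ m s" and "d = x r - x s"
    have num: "(1 - q powi (int (m r) - int (m s)) * x r / x s) * q ^ m s = - N / x s"
      using q_nonzero[OF norm_q] nz by (simp add: N_def power_int_diff field_simps)
    have den: "1 - x r / x s = - d / x s"
      using nz by (simp add: d_def field_simps)
    have "(1 - q powi (int (m r) - int (m s)) * x r / x s) / (1 - x r / x s) * q ^ m s
        = (- N / x s) / (- d / x s)"
      unfolding times_divide_eq_left num den ..
    also have "\<dots> = N / d"
      using nz by simp
    finally show "(1 - q powi (int (m r) - int (m s)) * x r / x s) / (1 - x r / x s) * q ^ m s
        = (x r * q ^ m r - x s * q ^ m s) / (x r - x s)"
      unfolding N_def d_def .
  qed
  finally show ?thesis .
qed

text \<open>The exponent r m_r splits into (r - 1) m_r, which completes the Vandermonde quotient,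
  and m_r, which adds up to |m| and is constant on each layer.\<close>

lemma inner_sum_eq: "inner_sum n q x p a k = inner_series q p a (msize n k)"
proof -
  define b where "b s = 1 / q ^ k s" for s
  define \<phi> where "\<phi> M = qpoch q a M * qpoch q q M ^ p" for M
  define F where "F m = milne_term n q x 1 b m * (q ^ msize n m * \<phi> (msize n m))" for m
  define K where "K = msize n k"
  have "inner_sum n q x p a k = (\<Sum>m\<in>multi_indices_upto n k. F m)"
    unfolding inner_sum_def
  proof (rule sum.cong[OF refl])
    fix m
    have "(\<Sum>r=1..n. r * m r) = (\<Sum>r=1..n. (r - 1) * m r + m r)"
      by (intro sum.cong refl) (auto simp: algebra_simps diff_mult_distrib)
    then have e: "q ^ (\<Sum>r=1..n. r * m r) = q ^ (\<Sum>r=1..n. (r - 1) * m r) * q ^ msize n m"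
      by (simp add: sum.distrib msize_def power_add)
    have f: "qpoch q (q powi (- int (k s)) * x r / x s) (m r) = (\<Prod>i<m r. 1 - b s * q ^ i * x r / x s)" for r s
      unfolding qpoch_def b_def power_int_minus power_int_of_nat by (simp add: field_simps)
    show "vandermonde_quot n q x m
        * (\<Prod>r=1..n. \<Prod>s=1..n. qpoch q (q powi (- int (k s)) * x r / x s) (m r) / qpoch q (q * x r / x s) (m r))
        * qpoch q a (msize n m) * qpoch q q (msize n m) ^ p * q ^ (\<Sum>r=1..n. r * m r) = F m"
      unfolding F_def \<phi>_def milne_term_def e f vandermonde_quot_eq[symmetric] by (simp only: mult_ac)
  qed
  \<comment> \<open>Outside the box some m_r > k_r, and the numerator factor with s = r and i = k_r
    is 0; so the box may be enlarged to |m| <= |k|.\<close>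
  also have "\<dots> = (\<Sum>m\<in>(\<Union>M\<in>{..K}. multi_indices_size n M). F m)"
  proof (rule sum.mono_neutral_left)
    show "multi_indices_upto n k \<subseteq> (\<Union>M\<in>{..K}. multi_indices_size n M)"
      by (auto simp: multi_indices_upto_def multi_indices_size_def multi_indices_def K_def msize_def PiE_iff
          intro!: sum_mono)
    show "\<forall>m\<in>(\<Union>M\<in>{..K}. multi_indices_size n M) - multi_indices_upto n k. F m = 0"
    proof
      fix m assume "m \<in> (\<Union>M\<in>{..K}. multi_indices_size n M) - multi_indices_upto n k"
      then obtain r where r: "r \<in> {1..n}" "k r < m r"
        by (auto simp: multi_indices_upto_def multi_indices_size_def multi_indices_def PiE_iff not_le)
      then have "(\<Prod>i<m r. 1 - b r * q ^ i * x r / x r) = 0"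
        using x_nonzero[of r] q_nonzero[OF norm_q] by (intro prod_zero) (auto simp: b_def)
      then have "milne_term n q x 1 b m = 0"
        unfolding milne_term_def using r(1)
        by (intro mult_eq_0_iff[THEN iffD2] disjI2 prod_zero finite_atLeastAtMost bexI[of _ r]) auto
      then show "F m = 0"
        by (simp add: F_def)
    qed
  qed (auto intro: finite_multi_indices_size)
  also have "\<dots> = (\<Sum>M\<le>K. \<Sum>m\<in>multi_indices_size n M. F m)"
    by (rule sum.UNION_disjoint) (simp_all add: finite_multi_indices_size, auto simp: multi_indices_size_def)
  also have "\<dots> = (\<Sum>M\<le>K. (\<Sum>m\<in>multi_indices_size n M. milne_term n q x 1 b m) * (q ^ M * \<phi> M))"
    unfolding sum_distrib_right
    by (intro sum.cong refl) (simp add: F_def multi_indices_size_def)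
  also have "\<dots> = inner_series q p a K"
  proof -
    have "(\<Prod>s\<in>{1..n}. b s) = 1 / q ^ K"
      by (simp add: b_def prod_dividef K_def msize_def power_sum)
    then have "(\<Prod>i<M. 1 ^ n - q ^ i * (\<Prod>s\<in>{1..n}. b s)) = qpoch q (1 / q ^ K) M" for M
      by (simp add: qpoch_def)
    then show ?thesis
      unfolding inner_series_def[OF norm_q]
      by (simp only: milne_theorem[OF norm_q x_nonzero x_distinct x_qpoch] \<phi>_def mult.assoc)
  qed
  finally show ?thesis
    by (simp add: K_def)
qed

abbreviation "outer_term \<equiv> milne_term n q x 0 (\<lambda>_. 1)"

text \<open>With u = 0 and a_s = 1 the numerator factors are -q^i x_r/x_s. Their product over r, s
  and i gives the sign, the binomial exponents and the powers x_r^(n k_r - |k|).\<close>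

lemma outer_term_eq:
  "vandermonde_quot n q x k / (\<Prod>r=1..n. \<Prod>s=1..n. qpoch q (q * x r / x s) (k r)) * outer_weight n q x k
     = outer_term k"
proof -
  define K where "K = msize n k"
  have 1: "(\<Prod>i<k r. 0 - 1 * q ^ i * x r / x s) = (-1) ^ k r * q ^ (k r choose 2) * (x r / x s) ^ k r" for r s
    using prod_neg_geometric[of q "x r / x s" "k r"] by simp
  have "(\<Prod>r=1..n. \<Prod>s=1..n. (x r / x s) ^ k r) = (\<Prod>r=1..n. x r ^ (n * k r)) / (\<Prod>r=1..n. \<Prod>s=1..n. x s ^ k r)"
    by (simp add: power_divide prod_dividef mult.commute flip: power_mult)
  also have "(\<Prod>r=1..n. \<Prod>s=1..n. x s ^ k r) = (\<Prod>s=1..n. x s ^ K)"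
    by (subst prod.swap) (simp add: K_def msize_def power_sum)
  also have "(\<Prod>r=1..n. x r ^ (n * k r)) / (\<Prod>s=1..n. x s ^ K) = (\<Prod>r=1..n. x r powi (int n * int (k r) - int K))"
    unfolding prod_dividef[symmetric]
    using x_nonzero by (intro prod.cong refl) (simp add: power_int_diff flip: of_nat_mult)
  finally have 2: "(\<Prod>r=1..n. \<Prod>s=1..n. (x r / x s) ^ k r) = (\<Prod>r=1..n. x r powi (int n * int (k r) - int K))" .
  have 3: "(\<Prod>r=1..n. \<Prod>s=1..n. (-1 :: complex) ^ k r) = (-1) ^ (n * K)"
    by (simp add: K_def msize_def sum_distrib_left power_sum mult.commute flip: power_mult)
  have 4: "(\<Prod>r=1..n. \<Prod>s=1..n. q ^ (k r choose 2)) = q ^ (n * (\<Sum>i=1..n. k i choose 2))"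
    by (simp add: sum_distrib_left power_sum mult.commute flip: power_mult)
  show ?thesis
    unfolding milne_term_def outer_weight_def 1 prod_dividef prod.distrib 2 3 4 power_add
      vandermonde_quot_eq[symmetric] K_def by (simp add: mult_ac)
qed

text \<open>
  \<open>c = 1\<close> gives the first series and \<open>c = 0\<close> the second; for \<open>c = 0\<close> and \<open>|k| = 0\<close> the
  truncated subtraction is harmless, since the factor \<open>1 - q ^ 0\<close> vanishes.
\<close>

definition summand :: "nat \<Rightarrow> nat \<Rightarrow> (nat \<Rightarrow> nat) \<Rightarrow> complex" where
  "summand c p k = outer_term k *
     ((1 - q ^ (2 * msize n k + c)) * qpoch q q (msize n k + c - 1) * inner_series q p (q ^ (msize n k + c)) (msize n k))"

lemma summand1_eq: "summand1 n q x p k = summand 1 p k"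
  unfolding summand1_def summand_def inner_sum_eq outer_term_eq[symmetric] by (simp add: mult_ac)

lemma summand2_eq: "summand2 n q x p k = summand 0 p k"
  unfolding summand2_def summand_def inner_sum_eq outer_term_eq[symmetric] by (simp add: mult_ac)

lemma sum_summand:
  assumes "c \<le> 1"
  shows "(\<Sum>k\<in>multi_indices_size n K. summand c p k) = bailey_sum q c (\<lambda>m. qpoch q q m ^ p) K"
proof -
  have "(\<Sum>k\<in>multi_indices_size n K. summand c p k) = (\<Sum>k\<in>multi_indices_size n K. outer_term k) *
      ((1 - q ^ (2 * K + c)) * qpoch q q (K + c - 1) * inner_series q p (q ^ (K + c)) K)"
    unfolding sum_distrib_right by (intro sum.cong refl) (simp add: summand_def multi_indices_size_def)
  also have "(\<Sum>k\<in>multi_indices_size n K. outer_term k) = (-1) ^ K * q ^ (K choose 2) / qpoch q q K"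
  proof -
    have "(\<Sum>k\<in>multi_indices_size n K. outer_term k)
        = (\<Prod>i<K. 0 ^ n - q ^ i * (\<Prod>s\<in>{1..n}. 1)) / qpoch q q K"
      by (rule milne_theorem[OF norm_q x_nonzero x_distinct x_qpoch])
    then show ?thesis
      \<comment> \<open>Since n >= 1, 0^n = 0, and the layer sum is free of n and x.\<close>
      using n prod_neg_geometric[of q 1 K] by (simp add: power_0_left)
  qed
  finally show ?thesis
    using bailey_sum_eq_inner_series[OF norm_q assms, of K p] by (simp add: mult_ac)
qed

section \<open>Absolute convergence of the n-fold series\<close>

lemma norm_vandermonde_ratio_le: "\<exists>C. \<forall>k. norm (vandermonde_ratio n q x k) \<le> C"
proof (intro exI allI)
  fix k
  have "norm (vandermonde_ratio n q x k)
      = (\<Prod>r\<in>{1..n}. \<Prod>s\<in>{r<..n}. norm ((x r * q ^ k r - x s * q ^ k s) / (x r - x s)))"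
    by (simp add: vandermonde_ratio_def prod_norm)
  also have "\<dots> \<le> (\<Prod>r\<in>{1..n}. \<Prod>s\<in>{r<..n}. (norm (x r) + norm (x s)) / norm (x r - x s))"
  proof (intro prod_mono conjI prod_nonneg ballI norm_ge_zero)
    fix r s
    have *: "norm (x r * q ^ k r) \<le> norm (x r)" for r
      using norm_q by (simp add: norm_mult norm_power mult_left_le power_le_one)
    have "norm (x r * q ^ k r - x s * q ^ k s) \<le> norm (x r) + norm (x s)"
      by (rule order.trans[OF norm_triangle_ineq4 add_mono[OF * *]])
    then show "norm ((x r * q ^ k r - x s * q ^ k s) / (x r - x s)) \<le> (norm (x r) + norm (x s)) / norm (x r - x s)"
      by (simp add: norm_divide divide_right_mono)
  qed
  finally show "norm (vandermonde_ratio n q x k) \<le> (\<Prod>r\<in>{1..n}. \<Prod>s\<in>{r<..n}. (norm (x r) + norm (x s)) / norm (x r - x s))" .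
qed

text \<open>Up to the bounded Vandermonde ratio, the norm of \<open>outer_term\<close> is a product
  of these over r, so n-fold summability follows from n single series.\<close>

definition outer_factor :: "nat \<Rightarrow> nat \<Rightarrow> real" where
  "outer_factor r j = (\<Prod>s\<in>{1..n}. norm ((\<Prod>i<j. 0 - 1 * q ^ i * x r / x s) / qpoch q (q * x r / x s) j))"

text \<open>The ratio of consecutive terms tends to 0, because every s contributes a factor of order
  |q|^j.\<close>

lemma summable_outer_factor:
  assumes r: "r \<in> {1..n}"
  shows "summable (outer_factor r)"
proof -
  define \<rho> where "\<rho> j = (\<Prod>s\<in>{1..n}. norm ((0 - 1 * q ^ j * x r / x s) / (1 - q * x r / x s * q ^ j)))" for j
  have qj: "(\<lambda>j. q ^ j) \<longlonglongrightarrow> 0"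
    using norm_q by (intro LIMSEQ_power_zero)
  have "\<rho> \<longlonglongrightarrow> (\<Prod>s\<in>{1..n}. norm ((0 - 1 * 0 * x r / x s) / (1 - q * x r / x s * 0)))"
    unfolding \<rho>_def using x_nonzero by (intro tendsto_intros qj) auto
  then have "\<rho> \<longlonglongrightarrow> 0"
    using n by (simp add: power_0_left)
  then have "eventually (\<lambda>j. \<rho> j < 1 / 2) sequentially"
    by (rule order_tendstoD) simp
  then obtain N where N: "\<And>j. N \<le> j \<Longrightarrow> \<rho> j < 1 / 2"
    by (auto simp: eventually_sequentially)
  have Suc: "outer_factor r (Suc j) = outer_factor r j * \<rho> j" for j
    unfolding outer_factor_def \<rho>_def prod.distrib[symmetric] norm_mult[symmetric]
    by (simp only: prod.lessThan_Suc qpoch_Suc times_divide_times_eq)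
  have nonneg: "0 \<le> outer_factor r j" for j
    unfolding outer_factor_def by (intro prod_nonneg) simp
  show ?thesis
  proof (rule summable_ratio_test[of "1 / 2" N])
    fix j assume "N \<le> j"
    then have "outer_factor r j * \<rho> j \<le> outer_factor r j * (1 / 2)"
      using N nonneg by (intro mult_left_mono) (auto intro: less_imp_le)
    then show "norm (outer_factor r (Suc j)) \<le> 1 / 2 * norm (outer_factor r j)"
      using nonneg[of j] nonneg[of "Suc j"] by (simp add: Suc)
  qed simp
qed

lemma summable_prod_outer_factor: "(\<lambda>k. \<Prod>r\<in>{1..n}. outer_factor r (k r)) summable_on multi_indices n"
proof -
  have nonneg: "0 \<le> outer_factor r j" for r j
    unfolding outer_factor_def by (intro prod_nonneg) simp
  have "Infinite_Set_Sum.abs_summable_on (\<lambda>k. \<Prod>r\<in>{1..n}. outer_factor r (k r)) (PiE {1..n} (\<lambda>_. UNIV))"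
    using summable_outer_factor nonneg
    by (intro abs_summable_on_prod_PiE) (auto simp: abs_summable_on_nat_iff')
  then show ?thesis
    unfolding multi_indices_def abs_summable_equivalent[symmetric] by (rule Infinite_Sum.abs_summable_summable)
qed

lemma summand_summable: "summand c p summable_on multi_indices n"
proof -
  obtain V where V: "\<And>k. norm (vandermonde_ratio n q x k) \<le> V"
    using norm_vandermonde_ratio_le by blast
  obtain I where I: "\<And>k. norm (inner_series q p (q ^ (k + c)) k) \<le> I"
    using inner_series_bounded[OF norm_q] by blast
  define D where "D = 2 * qpoch_bound q * I"
  have bound: "norm (summand c p k) \<le> V * D * (\<Prod>r\<in>{1..n}. outer_factor r (k r))" for k
  proof -
    define P where "P = (\<Prod>r\<in>{1..n}. outer_factor r (k r))"
    have P: "0 \<le> P"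
      unfolding P_def outer_factor_def by (intro prod_nonneg) simp
    have "norm (outer_term k) = norm (vandermonde_ratio n q x k) * P"
      by (simp add: milne_term_def norm_mult outer_factor_def P_def prod_norm)
    also have "\<dots> \<le> V * P"
      by (intro mult_right_mono V P)
    finally have 1: "norm (outer_term k) \<le> V * P" .
    have "norm (1 - q ^ (2 * msize n k + c)) \<le> 2"
      using norm_triangle_ineq4[of 1 "q ^ (2 * msize n k + c)"] norm_q power_le_one[of "norm q" "2 * msize n k + c"]
      by (simp add: norm_power)
    then have 2: "norm ((1 - q ^ (2 * msize n k + c)) * qpoch q q (msize n k + c - 1)
        * inner_series q p (q ^ (msize n k + c)) (msize n k)) \<le> D"
      unfolding norm_mult D_def using norm_q qpoch_bound_pos[OF norm_q]
      by (intro mult_mono norm_qpoch_le I) auto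
    have "0 \<le> V"
      using V order_trans norm_ge_zero by blast
    then have "norm (summand c p k) \<le> (V * P) * D"
      unfolding summand_def norm_mult[of "outer_term k"] using 1 2 P by (intro mult_mono) auto
    then show ?thesis
      by (simp add: P_def mult_ac)
  qed
  have "(\<lambda>k. norm (summand c p k)) summable_on multi_indices n"
    by (rule Infinite_Sum.abs_summable_on_comparison_test'[OF summable_on_cmult_right[OF summable_prod_outer_factor]])
       (rule bound)
  then show ?thesis
    by (rule Infinite_Sum.abs_summable_summable)
qed

lemma summand_has_sum:
  assumes "c \<le> 1"
  shows "(summand c p has_sum (qpoch_inf q q ^ (p + 1) - of_nat (1 - c))) (multi_indices n)"
proof -
  define T where "T = infsum (summand c p) (multi_indices n)"
  have T: "(summand c p has_sum T) (multi_indices n)"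
    unfolding T_def by (rule has_sum_infsum[OF summand_summable])
  \<comment> \<open>Grouping by |k|: each layer is finite and sums to a \<open>bailey_sum\<close>,
    and \<open>summand_summable\<close> makes the rearrangement legitimate.\<close>
  have "bij_betw snd (Sigma UNIV (multi_indices_size n)) (multi_indices n)"
    by (rule bij_betw_byWitness[where f' = "\<lambda>m. (msize n m, m)"]) (auto simp: multi_indices_size_def)
  then have "((\<lambda>z. summand c p (snd z)) has_sum T) (Sigma UNIV (multi_indices_size n))"
    using T by (simp add: has_sum_reindex_bij_betw)
  then have "((\<lambda>K. \<Sum>k\<in>multi_indices_size n K. summand c p k) has_sum T) UNIV"
    by (rule has_sum_SigmaD) (simp add: finite_multi_indices_size)
  then have "bailey_sum q c (\<lambda>m. qpoch q q m ^ p) sums T"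
    by (simp add: sum_summand[OF assms] has_sum_imp_sums)
  then have "(\<lambda>N. \<Sum>k\<le>N. bailey_sum q c (\<lambda>m. qpoch q q m ^ p) k) \<longlonglongrightarrow> T"
    by (simp add: sums_def_le)
  moreover have "(\<lambda>N. \<Sum>k\<le>N. bailey_sum q c (\<lambda>m. qpoch q q m ^ p) k)
      \<longlonglongrightarrow> qpoch_inf q q ^ (p + 1) - of_nat (1 - c)"
  proof -
    have "(\<Sum>k\<le>N. bailey_sum q c (\<lambda>m. qpoch q q m ^ p) k)
        = bailey_partial q c (\<lambda>m. qpoch q q m ^ p) N - of_nat (1 - c)" for N
      by (rule sum_bailey_sum[OF norm_q assms]) simp
    then show ?thesis
      by (simp only:) (intro tendsto_intros bailey_partial_LIMSEQ[OF norm_q])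
  qed
  ultimately have "T = qpoch_inf q q ^ (p + 1) - of_nat (1 - c)"
    by (rule LIMSEQ_unique)
  then show ?thesis
    using T by simp
qed

end

theorem theorem5p1:
  fixes q :: complex and n p :: nat and x :: "nat \<Rightarrow> complex"
  assumes q: "0 < norm q" "norm q < 1"
    and n: "n \<ge> 1"
    and x_nonzero: "\<And>r. r \<in> {1..n} \<Longrightarrow> x r \<noteq> 0"
    and denom_vandermonde: "\<And>r s. \<lbrakk>1 \<le> r; r < s; s \<le> n\<rbrakk> \<Longrightarrow> 1 - x r / x s \<noteq> 0"
    and denom_qpoch:
      "\<And>r s j. \<lbrakk>r \<in> {1..n}; s \<in> {1..n}\<rbrakk> \<Longrightarrow> qpoch q (q * x r / x s) j \<noteq> 0"
  shows "(summand1 n q x p summable_on multi_indices n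
          \<and> qpoch_inf q q ^ (p + 1) = (\<Sum>\<^sub>\<infinity>k\<in>multi_indices n. summand1 n q x p k))
       \<and> (summand2 n q x p summable_on {k \<in> multi_indices n. msize n k \<ge> 1}
          \<and> qpoch_inf q q ^ (p + 1) =
              1 + (\<Sum>\<^sub>\<infinity>k\<in>{k \<in> multi_indices n. msize n k \<ge> 1}. summand2 n q x p k))"
proof -
  note assms = q n x_nonzero denom_vandermonde denom_qpoch
  have "summand1 n q x p = summand q n x 1 p"
    by (rule ext) (rule summand1_eq[OF assms])
  then have 1: "(summand1 n q x p has_sum qpoch_inf q q ^ (p + 1)) (multi_indices n)"
    using summand_has_sum[OF assms, where c = 1 and p = p] by simp
  have "summand2 n q x p = summand q n x 0 p"
    by (rule ext) (rule summand2_eq[OF assms])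
  then have "(summand2 n q x p has_sum (qpoch_inf q q ^ (p + 1) - 1)) (multi_indices n)"
    using summand_has_sum[OF assms, where c = 0 and p = p] by simp
  \<comment> \<open>The factor 1 - q^0 kills the zero multi-index, so restricting to |k| >= 1 keeps
    the sum.\<close>
  moreover have "summand2 n q x p k = 0" if "msize n k = 0" for k
    using that by (simp add: summand2_def)
  ultimately have 2: "(summand2 n q x p has_sum (qpoch_inf q q ^ (p + 1) - 1)) {k \<in> multi_indices n. msize n k \<ge> 1}"
    by (subst has_sum_cong_neutral[where T = "multi_indices n" and g = "summand2 n q x p"]) auto
  show ?thesis
    using has_sum_imp_summable[OF 1] infsumI[OF 1] has_sum_imp_summable[OF 2] infsumI[OF 2] by simp
qed

end
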